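(* The finite dimensional irreducible real representations of $iD_\infty$ are, up to isomorphism, precisely the representations $$V=\mathbb{R}[t]/(p)\oplus b\,\mathbb{R}[t]/(p),$$ where $p\in\mathbb{R}[t]$ is either $p=t-r$ with $r\in\mathbb{R}\setminus\{0\}$, or $p=(t-c)(t-\overline{c})$ with $c\in\mathbb{C}\setminus\mathbb{R}$.
   Context: $iD_\infty$ is the associative unital algebra over $\mathbb{R}$ generated by two elements $a,b$ ($a$ and $b$ invertible) subject to the relations $bab^{-1}=a^{-1}$ and $b^2=-1$. A real representation is a left $iD_\infty$-module that is a real vector space. Notation: for $p\in\mathbb{R}[t]$ with $p(0)\neq 0$ (so that $t$ is invertible in $\mathbb{R}[t]/(p)$), $V=\mathbb{R}[t]/(p)\oplus b\,\mathbb{R}[t]/(p)$ denotes the $iD_\infty$-module whose underlying vector space is the direct sum of $\mathbb{R}[t]/(p)$ and a second copy of it, with elements written $b f$ for $f\in\mathbb{R}[t]/(p)$, and with action, for $f\in \mathbb{R}[t]/(p)$, $$a\cdot f=tf,\quad a\cdot (bf)=b(t^{-1}f),\quad b\cdot f=bf,\quad b\cdot(bf)=-f.$$ *)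

theory Defs
  imports
    "HOL-Algebra.Algebraic_Closure_Type"
    "HOL-Algebra.QuotRing"
    "HOL-Algebra.Module"
    "HOL-Library.Poly_Mapping"
    "HOL.Complex"
begin

section \<open>The algebra \<open>iD\<^sub>\<infinity>\<close> by generators and relations\<close>

text \<open>
  The free monoid on four letters, written additively so that finitely supported functions on it
  form the free algebra under the convolution product of \<^typ>\<open>'a \<Rightarrow>\<^sub>0 'b\<close>.
  Invertibility of \<open>a\<close> and \<open>b\<close> is imposed by adjoining letters for the inverses.
\<close>

datatype letter = Ga | Ga_inv | Gb | Gb_inv

datatype word = Word (letters: "letter list")

instantiation word :: monoid_add
begin

definition zero_word :: word where "0 = Word []"

definition plus_word :: "word \<Rightarrow> word \<Rightarrow> word"
  where "u + v = Word (letters u @ letters v)"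

instance
  by standard (auto simp: zero_word_def plus_word_def)

end

type_synonym free_alg = "word \<Rightarrow>\<^sub>0 real"

abbreviation Free :: "free_alg ring" where "Free \<equiv> ring_of_type_algebra"

definition gen :: "letter \<Rightarrow> free_alg"
  where "gen l = Poly_Mapping.single (Word [l]) 1"

definition relators :: "free_alg set"
  where "relators =
    {gen Ga * gen Ga_inv - 1, gen Ga_inv * gen Ga - 1,
     gen Gb * gen Gb_inv - 1, gen Gb_inv * gen Gb - 1,
     gen Gb * gen Ga * gen Gb_inv - gen Ga_inv,
     gen Gb * gen Gb + 1}"

definition relation_ideal :: "free_alg set"
  where "relation_ideal = Idl\<^bsub>Free\<^esub> relators"

definition iD :: "free_alg set ring"
  where "iD = Free Quot relation_ideal"

definition iD_class :: "free_alg \<Rightarrow> free_alg set"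
  where "iD_class x = relation_ideal +>\<^bsub>Free\<^esub> x"

definition iD_a :: "free_alg set" where "iD_a = iD_class (gen Ga)"

definition iD_b :: "free_alg set" where "iD_b = iD_class (gen Gb)"

definition iD_scalar :: "real \<Rightarrow> free_alg set"
  where "iD_scalar r = iD_class (Poly_Mapping.single 0 r)"


section \<open>Left modules over a possibly noncommutative ring\<close>

text \<open>
  The locale \<^locale>\<open>module\<close> requires a commutative base ring; these are its axioms over a ring.
  In the record \<^typ>\<open>('a, 'b) module\<close> the fields for a multiplication and a unit are irrelevant.
\<close>

locale left_module = R?: ring R + M?: abelian_group M
  for R :: "('a, 'r) ring_scheme" (structure)
    and M :: "('a, 'v, 'm) module_scheme" (structure) +
  assumes smult_closed:
      "\<lbrakk>x \<in> carrier R; v \<in> carrier M\<rbrakk> \<Longrightarrow> x \<odot>\<^bsub>M\<^esub> v \<in> carrier M"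
    and smult_l_distr:
      "\<lbrakk>x \<in> carrier R; y \<in> carrier R; v \<in> carrier M\<rbrakk> \<Longrightarrow>
        (x \<oplus>\<^bsub>R\<^esub> y) \<odot>\<^bsub>M\<^esub> v = x \<odot>\<^bsub>M\<^esub> v \<oplus>\<^bsub>M\<^esub> y \<odot>\<^bsub>M\<^esub> v"
    and smult_r_distr:
      "\<lbrakk>x \<in> carrier R; v \<in> carrier M; w \<in> carrier M\<rbrakk> \<Longrightarrow>
        x \<odot>\<^bsub>M\<^esub> (v \<oplus>\<^bsub>M\<^esub> w) = x \<odot>\<^bsub>M\<^esub> v \<oplus>\<^bsub>M\<^esub> x \<odot>\<^bsub>M\<^esub> w"
    and smult_assoc:
      "\<lbrakk>x \<in> carrier R; y \<in> carrier R; v \<in> carrier M\<rbrakk> \<Longrightarrow>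
        (x \<otimes>\<^bsub>R\<^esub> y) \<odot>\<^bsub>M\<^esub> v = x \<odot>\<^bsub>M\<^esub> (y \<odot>\<^bsub>M\<^esub> v)"
    and smult_one:
      "v \<in> carrier M \<Longrightarrow> \<one>\<^bsub>R\<^esub> \<odot>\<^bsub>M\<^esub> v = v"

definition irreducible_module :: "'a ring \<Rightarrow> ('a, 'v) module \<Rightarrow> bool"
  where "irreducible_module R M \<longleftrightarrow>
    left_module R M \<and> carrier M \<noteq> {\<zero>\<^bsub>M\<^esub>} \<and>
    (\<forall>H. submodule H R M \<longrightarrow> H = {\<zero>\<^bsub>M\<^esub>} \<or> H = carrier M)"

definition module_isomorphic :: "'a ring \<Rightarrow> ('a, 'v) module \<Rightarrow> ('a, 'w) module \<Rightarrow> bool"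
  where "module_isomorphic R M N \<longleftrightarrow>
    (\<exists>\<phi>. bij_betw \<phi> (carrier M) (carrier N) \<and>
      (\<forall>v\<in>carrier M. \<forall>w\<in>carrier M. \<phi> (v \<oplus>\<^bsub>M\<^esub> w) = \<phi> v \<oplus>\<^bsub>N\<^esub> \<phi> w) \<and>
      (\<forall>x\<in>carrier R. \<forall>v\<in>carrier M. \<phi> (x \<odot>\<^bsub>M\<^esub> v) = x \<odot>\<^bsub>N\<^esub> \<phi> v))"

text \<open>
  The real vector space structure of an \<open>iD\<^sub>\<infinity>\<close>-module is the one given by the unital algebra
  structure map from \<open>\<real>\<close> to \<open>iD\<^sub>\<infinity>\<close>, so module isomorphisms are automatically real linear.
\<close>

definition finite_dimensional_rep :: "(free_alg set, 'v) module \<Rightarrow> bool"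
  where "finite_dimensional_rep M \<longleftrightarrow>
    (\<exists>S. finite S \<and> S \<subseteq> carrier M \<and>
      (\<forall>v\<in>carrier M. \<exists>c :: 'v \<Rightarrow> real. v = (\<Oplus>\<^bsub>M\<^esub>u\<in>S. iD_scalar (c u) \<odot>\<^bsub>M\<^esub> u)))"


section \<open>The modules \<open>\<real>[t]/(p) \<oplus> b \<real>[t]/(p)\<close>\<close>

abbreviation Rt :: "real poly ring" where "Rt \<equiv> ring_of_type_algebra"

definition Rtmod :: "real poly \<Rightarrow> real poly set ring"
  where "Rtmod p = Rt Quot (PIdl\<^bsub>Rt\<^esub> p)"

definition Rtmod_class :: "real poly \<Rightarrow> real poly \<Rightarrow> real poly set"
  where "Rtmod_class p f = PIdl\<^bsub>Rt\<^esub> p +>\<^bsub>Rt\<^esub> f"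

text \<open>
  A pair \<open>(f, g)\<close> stands for \<open>f + b g\<close>. The inverse of \<open>t\<close> is meaningful when \<open>p(0) \<noteq> 0\<close>.
\<close>

fun letter_action ::
  "real poly \<Rightarrow> letter \<Rightarrow> real poly set \<times> real poly set \<Rightarrow> real poly set \<times> real poly set"
  where
    "letter_action p Ga (f, g) =
      (Rtmod_class p [:0, 1:] \<otimes>\<^bsub>Rtmod p\<^esub> f,
       inv\<^bsub>Rtmod p\<^esub> (Rtmod_class p [:0, 1:]) \<otimes>\<^bsub>Rtmod p\<^esub> g)"
  | "letter_action p Ga_inv (f, g) =
      (inv\<^bsub>Rtmod p\<^esub> (Rtmod_class p [:0, 1:]) \<otimes>\<^bsub>Rtmod p\<^esub> f,
       Rtmod_class p [:0, 1:] \<otimes>\<^bsub>Rtmod p\<^esub> g)"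
  | "letter_action p Gb (f, g) = (\<ominus>\<^bsub>Rtmod p\<^esub> g, f)"
  | "letter_action p Gb_inv (f, g) = (g, \<ominus>\<^bsub>Rtmod p\<^esub> f)"

definition word_action ::
  "real poly \<Rightarrow> word \<Rightarrow> real poly set \<times> real poly set \<Rightarrow> real poly set \<times> real poly set"
  where "word_action p w = foldr (letter_action p) (letters w)"

definition free_action ::
  "real poly \<Rightarrow> free_alg \<Rightarrow> real poly set \<times> real poly set \<Rightarrow> real poly set \<times> real poly set"
  where "free_action p x v =
    ((\<Oplus>\<^bsub>Rtmod p\<^esub>w\<in>Poly_Mapping.keys x. Rtmod_class p [:Poly_Mapping.lookup x w:] \<otimes>\<^bsub>Rtmod p\<^esub> fst (word_action p w v)),
     (\<Oplus>\<^bsub>Rtmod p\<^esub>w\<in>Poly_Mapping.keys x. Rtmod_class p [:Poly_Mapping.lookup x w:] \<otimes>\<^bsub>Rtmod p\<^esub> snd (word_action p w v)))"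

text \<open>
  An element of \<open>iD\<^sub>\<infinity>\<close> is a coset \<open>U\<close>; for \<open>p(0) \<noteq> 0\<close> all its members act in the same way
  (see \<open>V_rep_smult\<close> below), and \<^const>\<open>the_elem\<close> picks out their common value. The fields for a
  multiplication and a unit play no role.
\<close>

definition V_rep :: "real poly \<Rightarrow> (free_alg set, real poly set \<times> real poly set) module"
  where "V_rep p =
    \<lparr>carrier = carrier (Rtmod p) \<times> carrier (Rtmod p),
     monoid.mult = undefined, one = undefined,
     ring.zero = (\<zero>\<^bsub>Rtmod p\<^esub>, \<zero>\<^bsub>Rtmod p\<^esub>),
     add = (\<lambda>v w. (fst v \<oplus>\<^bsub>Rtmod p\<^esub> fst w, snd v \<oplus>\<^bsub>Rtmod p\<^esub> snd w)),
     module.smult = (\<lambda>U v. the_elem ((\<lambda>x. free_action p x v) ` U))\<rparr>"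

definition admissible :: "real poly \<Rightarrow> bool"
  where "admissible p \<longleftrightarrow>
    (\<exists>r::real. r \<noteq> 0 \<and> p = [:- r, 1:]) \<or>
    (\<exists>c::complex. c \<notin> \<real> \<and> map_poly complex_of_real p = [:- c, 1:] * [:- cnj c, 1:])"

section \<open>The quotients and the action are well defined\<close>


lemma ring_type_ring_1: "ring (ring_of_type_algebra :: 'a::ring_1 ring)"
proof -
  have "\<exists>y. x + y = 0" for x :: 'a
    using add.right_inverse by blast
  thus ?thesis
    unfolding ring_of_type_algebra_def using add.right_inverse
    by unfold_locales (auto simp: algebra_simps Units_def)
qed

lemma ring_type_simps [simp]:
  "carrier ring_of_type_algebra = UNIV" "x \<otimes>\<^bsub>ring_of_type_algebra\<^esub> y = x * y"
  "x \<oplus>\<^bsub>ring_of_type_algebra\<^esub> y = x + y" "\<one>\<^bsub>ring_of_type_algebra\<^esub> = 1"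
  "\<zero>\<^bsub>ring_of_type_algebra\<^esub> = 0"
  by (simp_all add: ring_of_type_algebra_def)

lemma ring_type_minus [simp]: "\<ominus>\<^bsub>ring_of_type_algebra\<^esub> (x::'a::ring_1) = - x"
proof -
  interpret ring "ring_of_type_algebra :: 'a ring" by (rule ring_type_ring_1)
  show ?thesis by (rule minus_equality) auto
qed

lemma relation_ideal_ideal: "ideal relation_ideal Free"
proof -
  interpret ring Free by (rule ring_type_ring_1)
  show ?thesis unfolding relation_ideal_def by (rule genideal_ideal) simp
qed

lemma ring_iD: "ring iD"
  unfolding iD_def by (rule ideal.quotient_is_ring[OF relation_ideal_ideal])

lemma iD_class_ring_hom: "ring_hom_ring Free iD iD_class"
  using ideal.rcos_ring_hom_ring[OF relation_ideal_ideal]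
  by (simp add: iD_def iD_class_def[abs_def])

lemma ring_type_coset_eq_iff:
  fixes x y :: "'a::ring_1"
  assumes "ideal I (ring_of_type_algebra :: 'a ring)"
  shows "I +>\<^bsub>ring_of_type_algebra\<^esub> x = I +>\<^bsub>ring_of_type_algebra\<^esub> y \<longleftrightarrow> x - y \<in> I"
proof -
  interpret I: ideal I "ring_of_type_algebra :: 'a ring" by (rule assms)
  have zero: "0 \<in> I" using additive_subgroup.zero_closed[OF I.additive_subgroup_axioms] by simp
  have add: "u + v \<in> I" if "u \<in> I" "v \<in> I" for u v using additive_subgroup.a_closed[OF I.additive_subgroup_axioms that] by simp
  have neg: "- u \<in> I" if "u \<in> I" for u using additive_subgroup.a_inv_closed[OF I.additive_subgroup_axioms that] by simp
  have coset: "I +>\<^bsub>ring_of_type_algebra\<^esub> z = {h + z |h. h \<in> I}" for z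
    by (auto simp: a_r_coset_def')
  have mem: "u \<in> {h + z |h. h \<in> I} \<longleftrightarrow> u - z \<in> I" for u z
    by (auto intro!: exI[of _ "u - z"])
  show ?thesis
  proof
    assume "I +>\<^bsub>ring_of_type_algebra\<^esub> x = I +>\<^bsub>ring_of_type_algebra\<^esub> y"
    moreover have "x \<in> I +>\<^bsub>ring_of_type_algebra\<^esub> x" unfolding coset mem using zero by simp
    ultimately show "x - y \<in> I" unfolding coset mem[symmetric] by blast
  next
    assume xy: "x - y \<in> I"
    have "u - x \<in> I \<longleftrightarrow> u - y \<in> I" for u
      using add[OF _ xy, of "u - x"] add[OF _ neg[OF xy], of "u - y"] by auto
    thus "I +>\<^bsub>ring_of_type_algebra\<^esub> x = I +>\<^bsub>ring_of_type_algebra\<^esub> y"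
      unfolding coset set_eq_iff mem by blast
  qed
qed

lemma iD_class_eq_iff: "iD_class x = iD_class y \<longleftrightarrow> x - y \<in> relation_ideal"
  unfolding iD_class_def by (rule ring_type_coset_eq_iff[OF relation_ideal_ideal])

lemma iD_relations:
  "iD_b \<otimes>\<^bsub>iD\<^esub> iD_b = \<ominus>\<^bsub>iD\<^esub> \<one>\<^bsub>iD\<^esub>"
  "iD_a \<in> Units iD" "iD_b \<in> Units iD"
  "iD_b \<otimes>\<^bsub>iD\<^esub> iD_a \<otimes>\<^bsub>iD\<^esub> inv\<^bsub>iD\<^esub> iD_b = inv\<^bsub>iD\<^esub> iD_a"
proof -
  interpret H: ring_hom_ring Free iD iD_class by (rule iD_class_ring_hom)
  have cl: "iD_class x \<in> carrier iD" for x using H.hom_closed[of x] by simp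
  have mult: "iD_class (x * y) = iD_class x \<otimes>\<^bsub>iD\<^esub> iD_class y" for x y
    using H.hom_mult[of x y] by simp
  have one: "iD_class 1 = \<one>\<^bsub>iD\<^esub>" using H.hom_one by simp
  have minus: "iD_class (- x) = \<ominus>\<^bsub>iD\<^esub> iD_class x" for x using H.hom_a_inv[of x] by simp
  have rel: "x - y \<in> relators \<Longrightarrow> iD_class x = iD_class y" for x y
    unfolding iD_class_eq_iff relation_ideal_def using H.R.genideal_self[of relators] by auto
  have a: "iD_a \<otimes>\<^bsub>iD\<^esub> iD_class (gen Ga_inv) = \<one>\<^bsub>iD\<^esub>" "iD_class (gen Ga_inv) \<otimes>\<^bsub>iD\<^esub> iD_a = \<one>\<^bsub>iD\<^esub>"
    and b: "iD_b \<otimes>\<^bsub>iD\<^esub> iD_class (gen Gb_inv) = \<one>\<^bsub>iD\<^esub>" "iD_class (gen Gb_inv) \<otimes>\<^bsub>iD\<^esub> iD_b = \<one>\<^bsub>iD\<^esub>"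
    unfolding iD_a_def iD_b_def mult[symmetric] one[symmetric]
    by (rule rel, simp add: relators_def)+
  have inv: "inv\<^bsub>iD\<^esub> iD_a = iD_class (gen Ga_inv)" "inv\<^bsub>iD\<^esub> iD_b = iD_class (gen Gb_inv)"
    using a b cl H.S.inv_unique' unfolding iD_a_def iD_b_def by metis+
  show "iD_a \<in> Units iD" "iD_b \<in> Units iD"
    using a b cl unfolding Units_def iD_a_def iD_b_def by blast+
  show "iD_b \<otimes>\<^bsub>iD\<^esub> iD_b = \<ominus>\<^bsub>iD\<^esub> \<one>\<^bsub>iD\<^esub>"
    unfolding iD_b_def mult[symmetric] one[symmetric] minus[symmetric]
    by (rule rel) (simp add: relators_def)
  show "iD_b \<otimes>\<^bsub>iD\<^esub> iD_a \<otimes>\<^bsub>iD\<^esub> inv\<^bsub>iD\<^esub> iD_b = inv\<^bsub>iD\<^esub> iD_a"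
    unfolding inv unfolding iD_a_def iD_b_def mult[symmetric]
    by (rule rel) (simp add: relators_def)
qed

lemma Rtmod_cring: "cring (Rtmod p)"
  unfolding Rtmod_def
  by (rule ideal.quotient_is_cring[OF cring.cgenideal_ideal]) (auto intro: cring_from_type_algebra)

lemma Rtmod_class_ring_hom: "ring_hom_ring Rt (Rtmod p) (Rtmod_class p)"
proof -
  interpret ideal "PIdl\<^bsub>Rt\<^esub> p" Rt
    by (rule cring.cgenideal_ideal) (auto intro: cring_from_type_algebra)
  show ?thesis using rcos_ring_hom_ring by (simp add: Rtmod_def Rtmod_class_def[abs_def])
qed

lemma Rtmod_class_eq_iff: "Rtmod_class p f = Rtmod_class p g \<longleftrightarrow> p dvd f - g"
proof -
  have "ideal (PIdl\<^bsub>Rt\<^esub> p) Rt"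
    by (rule cring.cgenideal_ideal) (auto intro: cring_from_type_algebra)
  hence "Rtmod_class p f = Rtmod_class p g \<longleftrightarrow> f - g \<in> PIdl\<^bsub>Rt\<^esub> p"
    unfolding Rtmod_class_def by (rule ring_type_coset_eq_iff)
  also have "\<dots> \<longleftrightarrow> p dvd f - g" by (auto simp: cgenideal_def dvd_def mult.commute)
  finally show ?thesis .
qed

lemma Rtmod_class_closed: "Rtmod_class p f \<in> carrier (Rtmod p)"
  using ring_hom_ring.homh[OF Rtmod_class_ring_hom, of p] by (auto simp: ring_hom_def)

lemma Rtmod_class_mult:
  "Rtmod_class p (f * g) = Rtmod_class p f \<otimes>\<^bsub>Rtmod p\<^esub> Rtmod_class p g"
  using ring_hom_ring.homh[OF Rtmod_class_ring_hom, of p] by (auto simp: ring_hom_def)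

lemma Rtmod_class_add:
  "Rtmod_class p (f + g) = Rtmod_class p f \<oplus>\<^bsub>Rtmod p\<^esub> Rtmod_class p g"
  using ring_hom_ring.homh[OF Rtmod_class_ring_hom, of p] by (auto simp: ring_hom_def)

lemma Rtmod_class_one: "Rtmod_class p 1 = \<one>\<^bsub>Rtmod p\<^esub>"
  using ring_hom_ring.homh[OF Rtmod_class_ring_hom, of p] by (auto simp: ring_hom_def)

lemma Rtmod_class_zero: "Rtmod_class p 0 = \<zero>\<^bsub>Rtmod p\<^esub>"
proof -
  interpret H: ring_hom_ring Rt "Rtmod p" "Rtmod_class p" by (rule Rtmod_class_ring_hom)
  show ?thesis using H.hom_zero by simp
qed

lemma Rtmod_t_unit:
  assumes "poly p 0 \<noteq> 0"
  shows "Rtmod_class p [:0, 1:] \<in> Units (Rtmod p)"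
proof -
  interpret T: cring "Rtmod p" by (rule Rtmod_cring)
  obtain c q where p: "p = pCons c q" by (cases p)
  with assms have c: "c \<noteq> 0" by simp
  define s where "s = smult (- 1 / c) q"
  have "s * [:0, 1:] - 1 = smult (- 1 / c) p"
    using c by (simp add: s_def p one_pCons)
  hence "Rtmod_class p (s * [:0, 1:]) = Rtmod_class p 1"
    unfolding Rtmod_class_eq_iff by (simp add: dvd_smult)
  hence "Rtmod_class p s \<otimes>\<^bsub>Rtmod p\<^esub> Rtmod_class p [:0, 1:] = \<one>\<^bsub>Rtmod p\<^esub>"
    by (simp only: Rtmod_class_mult Rtmod_class_one)
  thus ?thesis
    using Rtmod_class_closed T.m_comm unfolding Units_def by (smt (verit) mem_Collect_eq)
qed

lemma V_rep_simps:
  "carrier (V_rep p) = carrier (Rtmod p) \<times> carrier (Rtmod p)"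
  "\<zero>\<^bsub>V_rep p\<^esub> = (\<zero>\<^bsub>Rtmod p\<^esub>, \<zero>\<^bsub>Rtmod p\<^esub>)"
  "v \<oplus>\<^bsub>V_rep p\<^esub> w = (fst v \<oplus>\<^bsub>Rtmod p\<^esub> fst w, snd v \<oplus>\<^bsub>Rtmod p\<^esub> snd w)"
  "U \<odot>\<^bsub>V_rep p\<^esub> v = the_elem ((\<lambda>x. free_action p x v) ` U)"
  by (simp_all add: V_rep_def)

lemma V_rep_abelian_group: "abelian_group (V_rep p)"
proof -
  interpret T: cring "Rtmod p" by (rule Rtmod_cring)
  show ?thesis
  proof (rule abelian_groupI)
    fix v assume "v \<in> carrier (V_rep p)"
    thus "\<exists>w\<in>carrier (V_rep p). w \<oplus>\<^bsub>V_rep p\<^esub> v = \<zero>\<^bsub>V_rep p\<^esub>"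
      by (intro bexI[of _ "(\<ominus>\<^bsub>Rtmod p\<^esub> fst v, \<ominus>\<^bsub>Rtmod p\<^esub> snd v)"])
         (auto simp: V_rep_simps T.l_neg)
  qed (auto simp: V_rep_simps T.a_ac)
qed


context
  fixes p :: "real poly"
  assumes p0: "poly p 0 \<noteq> 0"
begin

interpretation T: cring "Rtmod p" by (rule Rtmod_cring)

lemma Rtmod_t_closed:
  "Rtmod_class p [:0, 1:] \<in> carrier (Rtmod p)"
  "inv\<^bsub>Rtmod p\<^esub> Rtmod_class p [:0, 1:] \<in> carrier (Rtmod p)"
  using Rtmod_t_unit[OF p0] by auto

lemma Rtmod_t_inv:
  assumes "f \<in> carrier (Rtmod p)"
  shows "Rtmod_class p [:0, 1:] \<otimes>\<^bsub>Rtmod p\<^esub> (inv\<^bsub>Rtmod p\<^esub> Rtmod_class p [:0, 1:] \<otimes>\<^bsub>Rtmod p\<^esub> f) = f"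
    "inv\<^bsub>Rtmod p\<^esub> Rtmod_class p [:0, 1:] \<otimes>\<^bsub>Rtmod p\<^esub> (Rtmod_class p [:0, 1:] \<otimes>\<^bsub>Rtmod p\<^esub> f) = f"
  using assms Rtmod_t_closed Rtmod_t_unit[OF p0] by (simp_all add: T.m_assoc[symmetric])

lemma letter_action_closed:
  "v \<in> carrier (V_rep p) \<Longrightarrow> letter_action p l v \<in> carrier (V_rep p)"
  using Rtmod_t_closed by (cases v; cases l) (auto simp: V_rep_simps)

lemma letter_action_add:
  "v \<in> carrier (V_rep p) \<Longrightarrow> w \<in> carrier (V_rep p) \<Longrightarrow>
    letter_action p l (v \<oplus>\<^bsub>V_rep p\<^esub> w) = letter_action p l v \<oplus>\<^bsub>V_rep p\<^esub> letter_action p l w"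
  using Rtmod_t_closed by (cases v; cases w; cases l) (auto simp: V_rep_simps T.r_distr T.minus_add)

definition scale_pair :: "real poly set \<Rightarrow> real poly set \<times> real poly set \<Rightarrow> real poly set \<times> real poly set"
  where "scale_pair s v = (s \<otimes>\<^bsub>Rtmod p\<^esub> fst v, s \<otimes>\<^bsub>Rtmod p\<^esub> snd v)"

lemma scale_pair_closed:
  "s \<in> carrier (Rtmod p) \<Longrightarrow> v \<in> carrier (V_rep p) \<Longrightarrow> scale_pair s v \<in> carrier (V_rep p)"
  by (auto simp: V_rep_simps scale_pair_def)

lemma letter_action_scale:
  "s \<in> carrier (Rtmod p) \<Longrightarrow> v \<in> carrier (V_rep p) \<Longrightarrow>
    letter_action p l (scale_pair s v) = scale_pair s (letter_action p l v)"
  using Rtmod_t_closed by (cases v; cases l) (auto simp: V_rep_simps scale_pair_def T.m_lcomm T.r_minus)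

lemma word_action_closed:
  assumes "v \<in> carrier (V_rep p)" shows "word_action p w v \<in> carrier (V_rep p)"
proof -
  have "foldr (letter_action p) ls v \<in> carrier (V_rep p)" for ls
    using assms by (induction ls) (auto intro: letter_action_closed)
  thus ?thesis by (simp add: word_action_def)
qed

lemma word_action_add:
  assumes "v \<in> carrier (V_rep p)" "u \<in> carrier (V_rep p)"
  shows "word_action p w (v \<oplus>\<^bsub>V_rep p\<^esub> u) = word_action p w v \<oplus>\<^bsub>V_rep p\<^esub> word_action p w u"
proof -
  have cl: "foldr (letter_action p) ls x \<in> carrier (V_rep p)" if "x \<in> carrier (V_rep p)" for ls x
    using word_action_closed[OF that, of "Word ls"] by (simp add: word_action_def)
  have "foldr (letter_action p) ls (v \<oplus>\<^bsub>V_rep p\<^esub> u)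
      = foldr (letter_action p) ls v \<oplus>\<^bsub>V_rep p\<^esub> foldr (letter_action p) ls u" for ls
    using assms by (induction ls) (auto simp: letter_action_add cl)
  thus ?thesis by (simp add: word_action_def)
qed

lemma word_action_scale:
  assumes "v \<in> carrier (V_rep p)" "s \<in> carrier (Rtmod p)"
  shows "word_action p w (scale_pair s v) = scale_pair s (word_action p w v)"
proof -
  have cl: "foldr (letter_action p) ls x \<in> carrier (V_rep p)" if "x \<in> carrier (V_rep p)" for ls x
    using word_action_closed[OF that, of "Word ls"] by (simp add: word_action_def)
  have "foldr (letter_action p) ls (scale_pair s v) = scale_pair s (foldr (letter_action p) ls v)" for ls
    using assms by (induction ls) (auto simp: letter_action_scale cl)
  thus ?thesis by (simp add: word_action_def)
qed

lemma word_action_plus: "word_action p (w + u) v = word_action p w (word_action p u v)"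
  by (simp add: word_action_def plus_word_def)

lemma word_action_pair_closed:
  assumes "v \<in> carrier (V_rep p)"
  shows "fst (word_action p w v) \<in> carrier (Rtmod p)" "snd (word_action p w v) \<in> carrier (Rtmod p)"
  using word_action_closed[OF assms, of w] by (auto simp: V_rep_simps)

lemma free_action_closed:
  assumes "v \<in> carrier (V_rep p)" shows "free_action p x v \<in> carrier (V_rep p)"
  unfolding free_action_def V_rep_simps
  using word_action_pair_closed[OF assms] Rtmod_class_closed by (auto intro!: T.finsum_closed)

lemma free_action_superset:
  assumes v: "v \<in> carrier (V_rep p)" and S: "finite S" "Poly_Mapping.keys x \<subseteq> S"
  shows "free_action p x v =
    ((\<Oplus>\<^bsub>Rtmod p\<^esub>w\<in>S. Rtmod_class p [:Poly_Mapping.lookup x w:] \<otimes>\<^bsub>Rtmod p\<^esub> fst (word_action p w v)),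
     (\<Oplus>\<^bsub>Rtmod p\<^esub>w\<in>S. Rtmod_class p [:Poly_Mapping.lookup x w:] \<otimes>\<^bsub>Rtmod p\<^esub> snd (word_action p w v)))"
proof -
  have "(\<Oplus>\<^bsub>Rtmod p\<^esub>w\<in>Poly_Mapping.keys x. Rtmod_class p [:Poly_Mapping.lookup x w:] \<otimes>\<^bsub>Rtmod p\<^esub> g w)
      = (\<Oplus>\<^bsub>Rtmod p\<^esub>w\<in>S. Rtmod_class p [:Poly_Mapping.lookup x w:] \<otimes>\<^bsub>Rtmod p\<^esub> g w)"
    if g: "\<And>w. g w \<in> carrier (Rtmod p)" for g
    by (rule T.add.finprod_mono_neutral_cong_left[OF S])
      (auto simp: Rtmod_class_closed Rtmod_class_zero in_keys_iff g)
  thus ?thesis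
    unfolding free_action_def using word_action_pair_closed[OF v] by simp
qed

lemma free_action_plus:
  assumes v: "v \<in> carrier (V_rep p)"
  shows "free_action p (x + y) v = free_action p x v \<oplus>\<^bsub>V_rep p\<^esub> free_action p y v"
proof -
  define S where "S = Poly_Mapping.keys x \<union> Poly_Mapping.keys y"
  have S: "finite S" "Poly_Mapping.keys x \<subseteq> S" "Poly_Mapping.keys y \<subseteq> S" "Poly_Mapping.keys (x + y) \<subseteq> S"
    using Poly_Mapping.keys_add[of x y] by (auto simp: S_def)
  have c: "Rtmod_class p [:a + b:] = Rtmod_class p [:a:] \<oplus>\<^bsub>Rtmod p\<^esub> Rtmod_class p [:b:]" for a b
    using Rtmod_class_add[of p "[:a:]" "[:b:]"] by simp
  show ?thesis
    unfolding free_action_superset[OF v S(1) S(2)] free_action_superset[OF v S(1) S(3)]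
      free_action_superset[OF v S(1) S(4)] V_rep_simps
    using word_action_pair_closed[OF v]
    by (simp add: Poly_Mapping.lookup_add c T.l_distr Rtmod_class_closed T.finsum_addf Pi_def)
qed

lemma free_action_single:
  assumes v: "v \<in> carrier (V_rep p)"
  shows "free_action p (Poly_Mapping.single w r) v = scale_pair (Rtmod_class p [:r:]) (word_action p w v)"
proof -
  have "Poly_Mapping.keys (Poly_Mapping.single w r) \<subseteq> {w}" by simp
  thus ?thesis
    using word_action_pair_closed[OF v]
    by (subst free_action_superset[OF v, of "{w}"]) (auto simp: scale_pair_def Rtmod_class_closed)
qed

lemma free_action_add:
  assumes v: "v \<in> carrier (V_rep p)" and u: "u \<in> carrier (V_rep p)"
  shows "free_action p x (v \<oplus>\<^bsub>V_rep p\<^esub> u) = free_action p x v \<oplus>\<^bsub>V_rep p\<^esub> free_action p x u"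
  unfolding free_action_def word_action_add[OF assms]
  unfolding V_rep_simps
  using word_action_pair_closed[OF v] word_action_pair_closed[OF u]
  by (simp add: T.r_distr Rtmod_class_closed T.finsum_addf Pi_def)

lemma scale_pair_add:
  "\<lbrakk>s \<in> carrier (Rtmod p); v \<in> carrier (V_rep p); u \<in> carrier (V_rep p)\<rbrakk> \<Longrightarrow>
    scale_pair s (v \<oplus>\<^bsub>V_rep p\<^esub> u) = scale_pair s v \<oplus>\<^bsub>V_rep p\<^esub> scale_pair s u"
  by (auto simp: scale_pair_def V_rep_simps T.r_distr)

lemma scale_pair_scale:
  "\<lbrakk>s \<in> carrier (Rtmod p); s' \<in> carrier (Rtmod p); v \<in> carrier (V_rep p)\<rbrakk> \<Longrightarrow>
    scale_pair s (scale_pair s' v) = scale_pair (s \<otimes>\<^bsub>Rtmod p\<^esub> s') v"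
  by (auto simp: scale_pair_def V_rep_simps T.m_assoc)

lemma free_action_zero: "v \<in> carrier (V_rep p) \<Longrightarrow> free_action p 0 v = \<zero>\<^bsub>V_rep p\<^esub>"
  by (simp add: free_action_def V_rep_simps)

lemma free_action_at_zero: "free_action p x \<zero>\<^bsub>V_rep p\<^esub> = \<zero>\<^bsub>V_rep p\<^esub>"
proof -
  interpret W: abelian_group "V_rep p" by (rule V_rep_abelian_group)
  show ?thesis
    using free_action_add[of "\<zero>\<^bsub>V_rep p\<^esub>" "\<zero>\<^bsub>V_rep p\<^esub>" x] free_action_closed[of "\<zero>\<^bsub>V_rep p\<^esub>" x]
    by (metis W.add.r_cancel_one W.l_zero W.zero_closed)
qed

lemma poly_mapping_update_eq_plus:
  "a \<notin> Poly_Mapping.keys f \<Longrightarrow> Poly_Mapping.update a b f = f + Poly_Mapping.single a b"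
  by (rule poly_mapping_eqI)
     (auto simp: Poly_Mapping.lookup_update Poly_Mapping.lookup_add Poly_Mapping.lookup_single in_keys_iff when_def)

lemma free_action_single_times:
  assumes v: "v \<in> carrier (V_rep p)"
  shows "free_action p (Poly_Mapping.single w r * y) v = free_action p (Poly_Mapping.single w r) (free_action p y v)"
proof (induction y rule: Poly_Mapping.update_induct)
  case const
  show ?case using v by (simp add: free_action_zero free_action_at_zero)
next
  case (update f a b)
  have 1: "Rtmod_class p [:r * b:] = Rtmod_class p [:r:] \<otimes>\<^bsub>Rtmod p\<^esub> Rtmod_class p [:b:]"
    using Rtmod_class_mult[of p "[:r:]" "[:b:]"] by (simp add: mult.commute)
  have "free_action p (Poly_Mapping.single w r * Poly_Mapping.single a b) v
      = free_action p (Poly_Mapping.single w r) (free_action p (Poly_Mapping.single a b) v)"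
    using v by (simp add: Poly_Mapping.mult_single free_action_single word_action_closed scale_pair_closed
        Rtmod_class_closed word_action_scale scale_pair_scale 1 word_action_plus)
  thus ?case
    using v update by (simp add: poly_mapping_update_eq_plus distrib_left free_action_plus free_action_add free_action_closed)
qed

lemma free_action_times:
  assumes v: "v \<in> carrier (V_rep p)"
  shows "free_action p (x * y) v = free_action p x (free_action p y v)"
proof (induction x rule: Poly_Mapping.update_induct)
  case const
  show ?case using v by (simp add: free_action_zero free_action_closed)
next
  case (update f a b)
  thus ?case
    using v by (simp add: poly_mapping_update_eq_plus distrib_right free_action_plus free_action_single_times free_action_closed)
qed

lemma free_action_one: 
  assumes v: "v \<in> carrier (V_rep p)"
  shows "free_action p 1 v = v"
proof -
  have 1: "Rtmod_class p [:1:] = \<one>\<^bsub>Rtmod p\<^esub>"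
    using Rtmod_class_one[of p] by (simp add: one_pCons)
  have "free_action p (Poly_Mapping.single 0 1) v = v"
    using v by (subst free_action_single) (auto simp: word_action_def zero_word_def scale_pair_def 1 V_rep_simps)
  thus ?thesis by simp
qed

lemma free_action_gen:
  assumes v: "v \<in> carrier (V_rep p)"
  shows "free_action p (gen l) v = letter_action p l v"
proof -
  have 1: "Rtmod_class p [:1:] = \<one>\<^bsub>Rtmod p\<^esub>"
    using Rtmod_class_one[of p] by (simp add: one_pCons)
  show ?thesis unfolding gen_def
    using v letter_action_closed[OF v, of l]
    by (subst free_action_single) (auto simp: word_action_def scale_pair_def 1 V_rep_simps)
qed

lemma relation_ideal_acts_trivially:
  assumes x: "x \<in> relation_ideal" and v: "v \<in> carrier (V_rep p)"
  shows "free_action p x v = \<zero>\<^bsub>V_rep p\<^esub>"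
proof -
  interpret F: ring Free by (rule ring_type_ring_1)
  interpret W: abelian_group "V_rep p" by (rule V_rep_abelian_group)
  define K where "K = {x. \<forall>v\<in>carrier (V_rep p). free_action p x v = \<zero>\<^bsub>V_rep p\<^esub>}"
  have neg: "free_action p (- y) v = \<ominus>\<^bsub>V_rep p\<^esub> free_action p y v" if "v \<in> carrier (V_rep p)" for y v
    using free_action_plus[OF that, of "- y" y] free_action_zero[OF that]
    by (metis W.minus_equality add.left_inverse free_action_closed that)
  have "ideal K Free"
  proof (rule idealI[OF F.ring_axioms])
    show "subgroup K (add_monoid Free)"
    proof (rule F.add.subgroupI)
      show "K \<noteq> {}" using free_action_zero unfolding K_def by blast
    qed (auto simp: K_def free_action_plus a_inv_def[symmetric] neg)
  qed (auto simp: K_def free_action_times free_action_closed free_action_at_zero)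
  moreover have "relators \<subseteq> K"
  proof -
    have *: "y - z \<in> K" if "\<And>v. v \<in> carrier (V_rep p) \<Longrightarrow> free_action p y v = free_action p z v" for y z
      using that free_action_plus[of _ y "- z"] unfolding K_def
      by (auto simp: neg free_action_closed W.r_neg)
    have "gen Gb * gen Gb - (- 1) \<in> K"
      by (rule *) (auto simp: neg free_action_times free_action_gen free_action_one letter_action_closed V_rep_simps
          intro!: W.minus_equality[symmetric] T.l_neg T.r_neg)
    moreover have "gen Ga * gen Ga_inv - 1 \<in> K" "gen Ga_inv * gen Ga - 1 \<in> K"
      "gen Gb * gen Gb_inv - 1 \<in> K" "gen Gb_inv * gen Gb - 1 \<in> K"
      "gen Gb * gen Ga * gen Gb_inv - gen Ga_inv \<in> K"
      using Rtmod_t_closed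
      by (auto intro!: * simp: free_action_times free_action_gen free_action_one letter_action_closed
          free_action_closed V_rep_simps Rtmod_t_inv T.r_minus)
    ultimately show ?thesis unfolding relators_def by auto
  qed
  ultimately have "relation_ideal \<subseteq> K"
    unfolding relation_ideal_def by (rule F.genideal_minimal)
  thus ?thesis using x v by (auto simp: K_def)
qed

lemma V_rep_smult:
  assumes v: "v \<in> carrier (V_rep p)"
  shows "iD_class x \<odot>\<^bsub>V_rep p\<^esub> v = free_action p x v"
proof -
  interpret I: ideal relation_ideal Free by (rule relation_ideal_ideal)
  interpret W: abelian_group "V_rep p" by (rule V_rep_abelian_group)
  have c: "iD_class x = {h + x |h. h \<in> relation_ideal}"
    by (auto simp: iD_class_def a_r_coset_def')
  have "0 \<in> relation_ideal"
    using additive_subgroup.zero_closed[OF I.additive_subgroup_axioms] by simp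
  hence "x \<in> iD_class x" unfolding c by force
  moreover have "free_action p y v = free_action p x v" if "y \<in> iD_class x" for y
  proof -
    obtain h where h: "h \<in> relation_ideal" "y = h + x" using \<open>y \<in> iD_class x\<close> unfolding c by blast
    have "free_action p y v = \<zero>\<^bsub>V_rep p\<^esub> \<oplus>\<^bsub>V_rep p\<^esub> free_action p x v"
      unfolding h(2) free_action_plus[OF v] relation_ideal_acts_trivially[OF h(1) v] ..
    thus ?thesis by (simp only: W.l_zero[OF free_action_closed[OF v]])
  qed
  ultimately have "(\<lambda>x. free_action p x v) ` iD_class x = {free_action p x v}" by blast
  thus ?thesis by (simp add: V_rep_simps)
qed

theorem V_rep_left_module: "left_module iD (V_rep p)"
proof -
  interpret W: abelian_group "V_rep p" by (rule V_rep_abelian_group)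
  have ex: "\<exists>x. U = iD_class x" if "U \<in> carrier iD" for U
    using that by (auto simp: iD_def iD_class_def FactRing_def A_RCOSETS_def')
  interpret H: ring_hom_ring Free iD iD_class by (rule iD_class_ring_hom)
  have h: "iD_class x \<otimes>\<^bsub>iD\<^esub> iD_class y = iD_class (x * y)"
    "iD_class x \<oplus>\<^bsub>iD\<^esub> iD_class y = iD_class (x + y)" "\<one>\<^bsub>iD\<^esub> = iD_class 1" for x y
    using H.hom_mult[of x y] H.hom_add[of x y] H.hom_one by simp_all
  have "left_module_axioms iD (V_rep p)"
  proof (rule left_module_axioms.intro)
    fix x v assume "x \<in> carrier iD" and v: "v \<in> carrier (V_rep p)"
    then obtain x' where x: "x = iD_class x'" using ex by blast
    show "x \<odot>\<^bsub>V_rep p\<^esub> v \<in> carrier (V_rep p)"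
      using v by (simp add: x V_rep_smult free_action_closed)
    fix w assume w: "w \<in> carrier (V_rep p)"
    show "x \<odot>\<^bsub>V_rep p\<^esub> (v \<oplus>\<^bsub>V_rep p\<^esub> w) = x \<odot>\<^bsub>V_rep p\<^esub> v \<oplus>\<^bsub>V_rep p\<^esub> x \<odot>\<^bsub>V_rep p\<^esub> w"
      using v w by (simp add: x V_rep_smult W.a_closed free_action_add)
  next
    fix x y v assume "x \<in> carrier iD" "y \<in> carrier iD" and v: "v \<in> carrier (V_rep p)"
    then obtain x' y' where x: "x = iD_class x'" "y = iD_class y'" using ex by metis
    show "(x \<oplus>\<^bsub>iD\<^esub> y) \<odot>\<^bsub>V_rep p\<^esub> v = x \<odot>\<^bsub>V_rep p\<^esub> v \<oplus>\<^bsub>V_rep p\<^esub> y \<odot>\<^bsub>V_rep p\<^esub> v"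
      using v by (simp add: x h V_rep_smult free_action_plus)
    show "(x \<otimes>\<^bsub>iD\<^esub> y) \<odot>\<^bsub>V_rep p\<^esub> v = x \<odot>\<^bsub>V_rep p\<^esub> (y \<odot>\<^bsub>V_rep p\<^esub> v)"
      using v by (simp add: x h V_rep_smult free_action_times free_action_closed)
  next
    fix v assume "v \<in> carrier (V_rep p)"
    thus "\<one>\<^bsub>iD\<^esub> \<odot>\<^bsub>V_rep p\<^esub> v = v"
      by (simp add: h V_rep_smult free_action_one)
  qed
  thus ?thesis by (intro left_module.intro ring_iD V_rep_abelian_group)
qed

theorem V_rep_action:
  assumes "f \<in> carrier (Rtmod p)" "g \<in> carrier (Rtmod p)"
  shows "iD_a \<odot>\<^bsub>V_rep p\<^esub> (f, g) =
      (Rtmod_class p [:0, 1:] \<otimes>\<^bsub>Rtmod p\<^esub> f,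
       inv\<^bsub>Rtmod p\<^esub> (Rtmod_class p [:0, 1:]) \<otimes>\<^bsub>Rtmod p\<^esub> g)"
    and "iD_b \<odot>\<^bsub>V_rep p\<^esub> (f, g) = (\<ominus>\<^bsub>Rtmod p\<^esub> g, f)"
    and "iD_scalar r \<odot>\<^bsub>V_rep p\<^esub> (f, g) =
      (Rtmod_class p [:r:] \<otimes>\<^bsub>Rtmod p\<^esub> f, Rtmod_class p [:r:] \<otimes>\<^bsub>Rtmod p\<^esub> g)"
proof -
  have fg: "(f, g) \<in> carrier (V_rep p)" using assms by (simp add: V_rep_simps)
  show "iD_a \<odot>\<^bsub>V_rep p\<^esub> (f, g) =
      (Rtmod_class p [:0, 1:] \<otimes>\<^bsub>Rtmod p\<^esub> f,
       inv\<^bsub>Rtmod p\<^esub> (Rtmod_class p [:0, 1:]) \<otimes>\<^bsub>Rtmod p\<^esub> g)"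
    and "iD_b \<odot>\<^bsub>V_rep p\<^esub> (f, g) = (\<ominus>\<^bsub>Rtmod p\<^esub> g, f)"
    unfolding iD_a_def iD_b_def V_rep_smult[OF fg] free_action_gen[OF fg] by simp_all
  show "iD_scalar r \<odot>\<^bsub>V_rep p\<^esub> (f, g) =
      (Rtmod_class p [:r:] \<otimes>\<^bsub>Rtmod p\<^esub> f, Rtmod_class p [:r:] \<otimes>\<^bsub>Rtmod p\<^esub> g)"
    unfolding iD_scalar_def V_rep_smult[OF fg] free_action_single[OF fg]
    by (simp add: word_action_def zero_word_def scale_pair_def)
qed

end

lemma admissible_poly_0:
  assumes "admissible p" shows "poly p 0 \<noteq> 0"
  using assms unfolding admissible_def
proof (elim disjE exE conjE)
  fix c assume c: "c \<notin> \<real>" and p: "map_poly complex_of_real p = [:- c, 1:] * [:- cnj c, 1:]"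
  have "complex_of_real (coeff p 0) = c * cnj c"
    using arg_cong[OF p, of "\<lambda>q. coeff q 0"] by (simp add: coeff_map_poly)
  moreover have "c \<noteq> 0" using c by auto
  ultimately show "poly p 0 \<noteq> 0" by (auto simp: poly_0_coeff_0)
qed auto

end

theory Submission
  imports Defs "HOL-Computational_Algebra.Fundamental_Theorem_Algebra"
begin

text \<open>
  The algebra consists of the elements \<open>F + b G\<close> with \<open>F, G\<close> Laurent polynomials in \<open>a\<close>. For a polynomial
  \<open>p\<close> with \<open>p(0) \<noteq> 0\<close>, the module \<open>V = \<real>[t]/(p) \<oplus> b \<real>[t]/(p)\<close> is therefore the quotient of \<open>iD\<^sub>\<infinity>\<close> by the left
  ideal generated by \<open>p(a)\<close> (\<open>annihilator_of_generator\<close>): to give a homomorphism from \<open>V\<close> to a module \<open>M\<close>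
  is to give a vector of \<open>M\<close> killed by \<open>p(a)\<close>.

  The admissible polynomials are exactly the minimal polynomials over \<open>\<real>\<close> of the nonzero complex numbers
  \<open>c\<close> (\<open>admissible_iff\<close>). This allows a uniform treatment of the linear and the quadratic ones:
  \<open>\<real>[t]/(p)\<close> is the field \<open>\<real>(c)\<close>, and everything is decided by evaluation at \<open>c\<close>.

  For such \<open>p\<close> the module \<open>V\<close> is irreducible (\<open>irreducible_V_rep\<close>). As a module over \<open>\<real>[a]\<close> it is a sum of
  two simple modules, on which \<open>a\<close> acts as \<open>c\<close> and as \<open>c\<^sup>-\<^sup>1\<close>, and \<open>b\<close> exchanges them. A proper nonzero
  submodule would be the graph of an isomorphism between the two, which forces \<open>c\<^sup>-\<^sup>1\<close> to be the
  conjugate of \<open>c\<close>, and \<open>b\<close> would then act on it as a conjugate-linear map of a line with square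
  \<open>- 1\<close>. Such a map is \<open>z \<mapsto> h z\<^sup>*\<close> with \<open>\<bar>h\<bar>\<^sup>2 = - 1\<close>, which is impossible
  (\<open>quaternionic_obstruction\<close>).

  Conversely, let \<open>M\<close> be irreducible of finite dimension. A complex root \<open>c\<close> of a polynomial of least
  degree in \<open>a\<close> that kills a nonzero vector yields a nonzero vector killed by \<open>p(a)\<close>, where \<open>p\<close> is the
  minimal polynomial of \<open>c\<close> (\<open>minimal_polynomial_vector\<close>). The resulting nonzero homomorphism from \<open>V\<close>
  to \<open>M\<close> is an isomorphism by Schur's lemma, which is used in terms of annihilators
  (\<open>isomorphic_if_annihilator_subset\<close>).
\<close>

section \<open>Normal forms \<open>F(a) + b G(a)\<close> modulo a left ideal\<close>

definition at_a :: "real poly \<Rightarrow> free_alg"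
  where "at_a q = fold_coeffs (\<lambda>c x. Poly_Mapping.single 0 c + gen Ga * x) q 0"

lemmas update_eq_plus = poly_mapping_update_eq_plus[of 1, simplified]

lemma scalar_central: "Poly_Mapping.single 0 c * (x :: free_alg) = x * Poly_Mapping.single 0 c"
proof (induction x rule: Poly_Mapping.update_induct)
  case (update f a b)
  thus ?case
    by (simp add: update_eq_plus distrib_left distrib_right Poly_Mapping.mult_single mult.commute)
qed simp

lemma at_a_0 [simp]: "at_a 0 = 0"
  by (simp add: at_a_def)

lemma at_a_pCons [simp]: "at_a (pCons c q) = Poly_Mapping.single 0 c + gen Ga * at_a q"
  by (cases "c = 0 \<and> q = 0") (auto simp: at_a_def)

lemma at_a_add: "at_a (p + q) = at_a p + at_a q"
  by (induction p q rule: poly_induct2) (simp_all add: Poly_Mapping.single_add algebra_simps)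

lemma at_a_smult: "at_a (smult c q) = Poly_Mapping.single 0 c * at_a q"
proof (induction q)
  case (pCons d q)
  have "gen Ga * (Poly_Mapping.single 0 c * at_a q) = Poly_Mapping.single 0 c * (gen Ga * at_a q)"
    by (metis scalar_central mult.assoc)
  thus ?case using pCons by (simp add: distrib_left Poly_Mapping.mult_single)
qed simp

lemma at_a_mult: "at_a (p * q) = at_a p * at_a q"
  by (induction p) (simp_all add: at_a_add at_a_smult algebra_simps)

lemma at_a_uminus: "at_a (- q) = - at_a q"
  using at_a_add[of q "- q"] by (simp add: eq_neg_iff_add_eq_0 add.commute)

lemma at_a_diff: "at_a (p - q) = at_a p - at_a q"
  using at_a_add[of p "- q"] by (simp add: at_a_uminus)

lemma free_alg_induct [case_names scalar gen add mult]:
  fixes x :: free_alg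
  assumes scalar: "\<And>c. P (Poly_Mapping.single 0 c)"
    and gen: "\<And>l. P (gen l)"
    and add: "\<And>x y. P x \<Longrightarrow> P y \<Longrightarrow> P (x + y)"
    and mult: "\<And>x y. P x \<Longrightarrow> P y \<Longrightarrow> P (x * y)"
  shows "P x"
proof (induction x rule: Poly_Mapping.update_induct)
  case const
  show ?case using scalar[of 0] by simp
next
  case (update f w c)
  have "P (Poly_Mapping.single (Word ls) c)" for ls
  proof (induction ls)
    case Nil
    show ?case using scalar[of c] by (simp add: zero_word_def)
  next
    case (Cons l ls)
    have "Poly_Mapping.single (Word (l # ls)) c = gen l * Poly_Mapping.single (Word ls) c"
      by (simp add: gen_def Poly_Mapping.mult_single plus_word_def)
    thus ?case using mult[OF gen Cons] by simp
  qed
  from this[of "letters w"] have "P (Poly_Mapping.single w c)" by simp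
  thus ?case using update add by (simp add: update_eq_plus)
qed

lemma relation_ideal_closed:
  "0 \<in> relation_ideal"
  "x \<in> relation_ideal \<Longrightarrow> y \<in> relation_ideal \<Longrightarrow> x + y \<in> relation_ideal"
  "x \<in> relation_ideal \<Longrightarrow> - x \<in> relation_ideal"
  "x \<in> relation_ideal \<Longrightarrow> y \<in> relation_ideal \<Longrightarrow> x - y \<in> relation_ideal"
  "x \<in> relation_ideal \<Longrightarrow> z * x \<in> relation_ideal"
  "x \<in> relation_ideal \<Longrightarrow> x * z \<in> relation_ideal"
proof -
  interpret I: ideal relation_ideal Free by (rule relation_ideal_ideal)
  show z: "0 \<in> relation_ideal"
    using additive_subgroup.zero_closed[OF I.additive_subgroup_axioms] by simp
  show a: "x + y \<in> relation_ideal" if "x \<in> relation_ideal" "y \<in> relation_ideal" for x y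
    using additive_subgroup.a_closed[OF I.additive_subgroup_axioms that] by simp
  show m: "- x \<in> relation_ideal" if "x \<in> relation_ideal" for x
    using additive_subgroup.a_inv_closed[OF I.additive_subgroup_axioms that] by simp
  show "x \<in> relation_ideal \<Longrightarrow> y \<in> relation_ideal \<Longrightarrow> x - y \<in> relation_ideal"
    using a[OF _ m, of x y] by simp
  show "x \<in> relation_ideal \<Longrightarrow> z * x \<in> relation_ideal"
    using I.I_l_closed[of x z] by simp
  show "x \<in> relation_ideal \<Longrightarrow> x * z \<in> relation_ideal"
    using I.I_r_closed[of x z] by simp
qed

text \<open>
  What normal forms need: \<open>b\<close> can be moved to the left of \<open>a\<close> and of its inverse, which it interchanges,
  and \<open>b\<^sup>-\<^sup>1\<close> and \<open>b\<^sup>2\<close> can be eliminated. All of this is derived from the defining relators by explicit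
  combinations.
\<close>

lemma relation_consequences:
  "gen Ga_inv * gen Ga - 1 \<in> relation_ideal"
  "gen Gb * gen Gb + 1 \<in> relation_ideal"
  "gen Gb_inv + gen Gb \<in> relation_ideal"
  "gen Ga_inv * gen Gb - gen Gb * gen Ga \<in> relation_ideal"
  "gen Ga * gen Gb - gen Gb * gen Ga_inv \<in> relation_ideal"
proof -
  interpret F: ring Free by (rule ring_type_ring_1)
  let ?A = "gen Ga" and ?A' = "gen Ga_inv" and ?B = "gen Gb" and ?B' = "gen Gb_inv"
  have "relators \<subseteq> relation_ideal"
    unfolding relation_ideal_def by (rule F.genideal_self) simp
  hence r: "?A * ?A' - 1 \<in> relation_ideal" "?A' * ?A - 1 \<in> relation_ideal"
    "?B' * ?B - 1 \<in> relation_ideal" "?B * ?A * ?B' - ?A' \<in> relation_ideal"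
    "?B * ?B + 1 \<in> relation_ideal"
    by (auto simp: relators_def)
  note cl = relation_ideal_closed
  show "?A' * ?A - 1 \<in> relation_ideal" "?B * ?B + 1 \<in> relation_ideal" by (rule r)+
  have "?B' + ?B = ?B' * (?B * ?B + 1) - (?B' * ?B - 1) * ?B"
    by (simp add: algebra_simps)
  thus "?B' + ?B \<in> relation_ideal" using r cl by metis
  have "?A' * ?B - ?B * ?A = ?B * ?A * (?B' * ?B - 1) - (?B * ?A * ?B' - ?A') * ?B"
    by (simp add: algebra_simps)
  thus AB: "?A' * ?B - ?B * ?A \<in> relation_ideal" using r cl by metis
  have "?A * ?B - ?B * ?A' =
      (?A * ?A' - 1) * (?B * ?A') - ?A * ?B * (?A * ?A' - 1) - ?A * (?A' * ?B - ?B * ?A) * ?A'"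
    by (simp add: algebra_simps)
  thus "?A * ?B - ?B * ?A' \<in> relation_ideal" using r AB cl by metis
qed

text \<open>
  The preimage in the free algebra of the left ideal of \<open>iD\<^sub>\<infinity>\<close> generated by \<open>p(a)\<close>. It kills every vector
  that \<open>p(a)\<close> kills. Working with this preimage keeps all computations in one ring type, where the
  simplifier knows the ring laws.
\<close>

definition left_multiples :: "real poly \<Rightarrow> free_alg set"
  where "left_multiples p = {x. \<exists>z. x - z * at_a p \<in> relation_ideal}"

lemma relation_in_left_multiples: "x \<in> relation_ideal \<Longrightarrow> x \<in> left_multiples p"
  unfolding left_multiples_def by (auto intro!: exI[of _ 0])

lemma left_multiples_add:
  assumes "x \<in> left_multiples p" "y \<in> left_multiples p"
  shows "x + y \<in> left_multiples p"
proof -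
  obtain z z' where "x - z * at_a p \<in> relation_ideal" "y - z' * at_a p \<in> relation_ideal"
    using assms unfolding left_multiples_def by blast
  from relation_ideal_closed(2)[OF this]
  have "x + y - (z + z') * at_a p \<in> relation_ideal" by (simp add: algebra_simps)
  thus ?thesis unfolding left_multiples_def by blast
qed

lemma left_multiples_mult:
  assumes "x \<in> left_multiples p"
  shows "y * x \<in> left_multiples p"
proof -
  obtain z where "x - z * at_a p \<in> relation_ideal"
    using assms unfolding left_multiples_def by blast
  from relation_ideal_closed(5)[OF this, of y]
  have "y * x - (y * z) * at_a p \<in> relation_ideal" by (simp add: algebra_simps)
  thus ?thesis unfolding left_multiples_def by blast
qed

lemma at_a_in_left_multiples: "p dvd q \<Longrightarrow> at_a q \<in> left_multiples p"
  unfolding left_multiples_def dvd_def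
  using relation_ideal_closed(1) by (metis (mono_tags, lifting) at_a_mult diff_self mem_Collect_eq mult.commute)

definition normal_form :: "real poly \<Rightarrow> real poly \<Rightarrow> free_alg"
  where "normal_form F G = at_a F + gen Gb * at_a G"

lemma normal_form_in_left_multiples:
  "p dvd F \<Longrightarrow> p dvd G \<Longrightarrow> normal_form F G \<in> left_multiples p"
  unfolding normal_form_def
  by (intro left_multiples_add left_multiples_mult at_a_in_left_multiples)

text \<open>
  If \<open>s\<close> inverts \<open>t\<close> modulo \<open>p\<close>, then \<open>G - t s G\<close> is a multiple of \<open>p\<close>; multiply it by \<open>a\<^sup>-\<^sup>1\<close> from the left.
  So the negative powers of \<open>a\<close>, which are not polynomials in \<open>a\<close>, can be eliminated.
\<close>

lemma inverse_mod_at_a: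
  assumes s: "p dvd s * [:0, 1:] - 1"
  shows "gen Ga_inv * at_a G - at_a (s * G) \<in> left_multiples p"
proof -
  have "G - [:0, 1:] * (s * G) = (s * [:0, 1:] - 1) * - G" by (simp add: algebra_simps)
  hence *: "at_a (G - [:0, 1:] * (s * G)) \<in> left_multiples p"
    using s by (intro at_a_in_left_multiples) (simp only: dvd_mult2)
  have "at_a (pCons 0 (s * G)) = gen Ga * at_a (s * G)" by simp
  hence "gen Ga_inv * at_a G - at_a (s * G) =
      gen Ga_inv * at_a (G - [:0, 1:] * (s * G)) + (gen Ga_inv * gen Ga - 1) * at_a (s * G)"
    by (simp add: at_a_diff algebra_simps del: at_a_pCons)
  thus ?thesis
    using left_multiples_mult[OF *] relation_ideal_closed(6)[OF relation_consequences(1)]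
    by (auto intro: left_multiples_add relation_in_left_multiples)
qed

text \<open>
  Normal forms are stable under left multiplication: for the generators this is a computation with the
  relations, and the property passes to sums and products.
\<close>

lemma mult_normal_form:
  assumes s: "p dvd s * [:0, 1:] - 1"
  shows "\<exists>F' G'. x * normal_form F G - normal_form F' G' \<in> left_multiples p"
proof (induction x arbitrary: F G rule: free_alg_induct)
  case (scalar c)
  have "Poly_Mapping.single 0 c * (gen Gb * y) = gen Gb * (Poly_Mapping.single 0 c * y)" for y
    by (metis scalar_central mult.assoc)
  hence "Poly_Mapping.single 0 c * normal_form F G = normal_form (smult c F) (smult c G)"
    by (simp add: normal_form_def at_a_smult distrib_left)
  thus ?case
    using relation_in_left_multiples[OF relation_ideal_closed(1)]
    by (intro exI[of _ "smult c F"] exI[of _ "smult c G"]) simp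
next
  case (gen l)
  note inv = inverse_mod_at_a[OF s]
  note rel = relation_in_left_multiples[OF relation_ideal_closed(6)[OF relation_consequences(5)]]
    relation_in_left_multiples[OF relation_ideal_closed(6)[OF relation_consequences(4)]]
    relation_in_left_multiples[OF relation_ideal_closed(6)[OF relation_consequences(3)]]
    relation_in_left_multiples[OF relation_ideal_closed(6)[OF relation_consequences(2)]]
  have b: "gen Gb * normal_form F G - normal_form (- G) F = (gen Gb * gen Gb + 1) * at_a G" for F G
    by (simp add: normal_form_def at_a_uminus algebra_simps)
  show ?case
  proof (cases l)
    case Ga
    have "gen Ga * normal_form F G - normal_form ([:0, 1:] * F) (s * G) =
        (gen Ga * gen Gb - gen Gb * gen Ga_inv) * at_a G
          + gen Gb * (gen Ga_inv * at_a G - at_a (s * G))"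
      by (simp add: normal_form_def algebra_simps)
    thus ?thesis
      using left_multiples_add[OF rel(1) left_multiples_mult[OF inv]] Ga by metis
  next
    case Ga_inv
    have "gen Ga_inv * normal_form F G - normal_form (s * F) ([:0, 1:] * G) =
        (gen Ga_inv * gen Gb - gen Gb * gen Ga) * at_a G
          + (gen Ga_inv * at_a F - at_a (s * F))"
      by (simp add: normal_form_def algebra_simps)
    thus ?thesis
      using left_multiples_add[OF rel(2) inv] Ga_inv by metis
  next
    case Gb
    show ?thesis using b rel(4) Gb by metis
  next
    case Gb_inv
    have "gen Gb_inv * normal_form F G - normal_form G (- F) =
        (gen Gb_inv + gen Gb) * normal_form F G + (gen Gb * gen Gb + 1) * at_a (- G)"
      by (simp add: normal_form_def at_a_uminus algebra_simps)
    thus ?thesis using left_multiples_add[OF rel(3,4)] Gb_inv by metis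
  qed
next
  case (add x y)
  obtain F1 G1 F2 G2 where "x * normal_form F G - normal_form F1 G1 \<in> left_multiples p"
    "y * normal_form F G - normal_form F2 G2 \<in> left_multiples p"
    using add by meson
  from left_multiples_add[OF this]
  have "(x + y) * normal_form F G - normal_form (F1 + F2) (G1 + G2) \<in> left_multiples p"
    by (simp add: normal_form_def at_a_add algebra_simps)
  thus ?case by blast
next
  case (mult x y)
  obtain F1 G1 where 1: "y * normal_form F G - normal_form F1 G1 \<in> left_multiples p"
    using mult by meson
  obtain F2 G2 where 2: "x * normal_form F1 G1 - normal_form F2 G2 \<in> left_multiples p"
    using mult by meson
  have "x * y * normal_form F G - normal_form F2 G2 \<in> left_multiples p"
    using left_multiples_add[OF left_multiples_mult[OF 1, of x] 2] by (simp add: algebra_simps)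
  thus ?case by blast
qed

lemma normal_form_exists:
  assumes "p dvd s * [:0, 1:] - 1"
  shows "\<exists>F G. x - normal_form F G \<in> left_multiples p"
proof -
  have "normal_form 1 0 = 1" by (simp add: normal_form_def one_pCons)
  thus ?thesis using mult_normal_form[OF assms, of x 1 0] by simp
qed

section \<open>Modules over \<open>iD\<^sub>\<infinity>\<close> and their irreducibility\<close>

lemma iD_class_hom:
  "iD_class x \<in> carrier iD"
  "iD_class (x + y) = iD_class x \<oplus>\<^bsub>iD\<^esub> iD_class y"
  "iD_class (x * y) = iD_class x \<otimes>\<^bsub>iD\<^esub> iD_class y"
  "iD_class 1 = \<one>\<^bsub>iD\<^esub>"
proof -
  interpret H: ring_hom_ring Free iD iD_class by (rule iD_class_ring_hom)
  show "iD_class x \<in> carrier iD" "iD_class (x + y) = iD_class x \<oplus>\<^bsub>iD\<^esub> iD_class y"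
    "iD_class (x * y) = iD_class x \<otimes>\<^bsub>iD\<^esub> iD_class y" "iD_class 1 = \<one>\<^bsub>iD\<^esub>"
    using H.hom_closed[of x] H.hom_add[of x y] H.hom_mult[of x y] H.hom_one by simp_all
qed

lemma iD_carrier: "carrier iD = range iD_class"
  by (auto simp: iD_def iD_class_def FactRing_def A_RCOSETS_def')

text \<open>
  Every element of \<open>iD\<^sub>\<infinity>\<close> is the class of an element of the free algebra. Letting the free algebra act
  replaces cosets by elements of a type with ring operations.
\<close>

locale iD_module = left_module iD M for M :: "(free_alg set, 'v) module"
begin

definition act :: "free_alg \<Rightarrow> 'v \<Rightarrow> 'v"
  where "act x v = iD_class x \<odot>\<^bsub>M\<^esub> v"

lemma act_closed [simp]: "v \<in> carrier M \<Longrightarrow> act x v \<in> carrier M"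
  by (simp add: act_def iD_class_hom smult_closed)

lemma act_plus: "v \<in> carrier M \<Longrightarrow> act (x + y) v = act x v \<oplus>\<^bsub>M\<^esub> act y v"
  by (simp add: act_def iD_class_hom smult_l_distr)

lemma act_times: "v \<in> carrier M \<Longrightarrow> act (x * y) v = act x (act y v)"
  by (simp add: act_def iD_class_hom smult_assoc)

lemma act_one [simp]: "v \<in> carrier M \<Longrightarrow> act 1 v = v"
  by (simp add: act_def iD_class_hom smult_one)

lemma act_add: "v \<in> carrier M \<Longrightarrow> w \<in> carrier M \<Longrightarrow> act x (v \<oplus>\<^bsub>M\<^esub> w) = act x v \<oplus>\<^bsub>M\<^esub> act x w"
  by (simp add: act_def iD_class_hom smult_r_distr)

lemma act_zero_left [simp]: "v \<in> carrier M \<Longrightarrow> act 0 v = \<zero>\<^bsub>M\<^esub>"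
  using act_plus[of v 0 0] by simp

lemma act_zero_right [simp]: "act x \<zero>\<^bsub>M\<^esub> = \<zero>\<^bsub>M\<^esub>"
  using act_add[of "\<zero>\<^bsub>M\<^esub>" "\<zero>\<^bsub>M\<^esub>" x] by simp

lemma act_minus: "v \<in> carrier M \<Longrightarrow> act (- x) v = \<ominus>\<^bsub>M\<^esub> act x v"
  using act_plus[of v "- x" x] by (simp add: M.minus_equality)

lemma act_eqI:
  assumes "v \<in> carrier M" "act (x - y) v = \<zero>\<^bsub>M\<^esub>"
  shows "act x v = act y v"
  using act_plus[of v "x - y" y] assms by simp

lemma act_diff_zero:
  assumes "v \<in> carrier M" "act x v = act y v"
  shows "act (x - y) v = \<zero>\<^bsub>M\<^esub>"
  using act_plus[of v x "- y"] assms by (simp add: act_minus M.r_neg)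

lemma act_relation_ideal:
  assumes "v \<in> carrier M" "x \<in> relation_ideal"
  shows "act x v = \<zero>\<^bsub>M\<^esub>"
proof -
  have "iD_class x = iD_class 0" using assms by (simp add: iD_class_eq_iff)
  thus ?thesis using act_zero_left[of v] assms by (simp add: act_def)
qed

lemma act_left_multiples:
  assumes v: "v \<in> carrier M" "act (at_a p) v = \<zero>\<^bsub>M\<^esub>" and x: "x \<in> left_multiples p"
  shows "act x v = \<zero>\<^bsub>M\<^esub>"
proof -
  obtain z where z: "x - z * at_a p \<in> relation_ideal"
    using x unfolding left_multiples_def by blast
  have "act x v = act (z * at_a p) v"
    using v(1) z by (intro act_eqI act_relation_ideal)
  thus ?thesis using v by (simp add: act_times)
qed

lemma smult_iD: "U \<in> carrier iD \<Longrightarrow> \<exists>x. \<forall>v. U \<odot>\<^bsub>M\<^esub> v = act x v"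
  unfolding act_def iD_carrier by auto

lemma submodule_iff:
  "submodule H iD M \<longleftrightarrow> H \<subseteq> carrier M \<and> \<zero>\<^bsub>M\<^esub> \<in> H \<and>
    (\<forall>v\<in>H. \<forall>w\<in>H. v \<oplus>\<^bsub>M\<^esub> w \<in> H) \<and> (\<forall>x. \<forall>v\<in>H. act x v \<in> H)"
proof
  assume H: "submodule H iD M"
  interpret H: submodule H iD M by (rule H)
  show "H \<subseteq> carrier M \<and> \<zero>\<^bsub>M\<^esub> \<in> H \<and>
    (\<forall>v\<in>H. \<forall>w\<in>H. v \<oplus>\<^bsub>M\<^esub> w \<in> H) \<and> (\<forall>x. \<forall>v\<in>H. act x v \<in> H)"
    using H.subset H.one_closed H.m_closed H.smult_closed by (auto simp: act_def iD_class_hom)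
next
  assume H: "H \<subseteq> carrier M \<and> \<zero>\<^bsub>M\<^esub> \<in> H \<and>
    (\<forall>v\<in>H. \<forall>w\<in>H. v \<oplus>\<^bsub>M\<^esub> w \<in> H) \<and> (\<forall>x. \<forall>v\<in>H. act x v \<in> H)"
  have "subgroup H (add_monoid M)"
  proof (rule M.add.subgroupI)
    show "\<ominus>\<^bsub>M\<^esub> v \<in> H" if "v \<in> H" for v
      using H that act_minus[of v 1] act_one[of v] by (metis subsetD)
  qed (use H in auto)
  moreover have "U \<odot>\<^bsub>M\<^esub> v \<in> H" if "U \<in> carrier iD" "v \<in> H" for U v
    using smult_iD[OF that(1)] H that(2) by metis
  ultimately show "submodule H iD M"
    by (simp add: submodule_def submodule_axioms_def)
qed

text \<open>
  The orbit of a vector under the algebra is a submodule, so irreducibility says that every nonzero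
  vector generates the whole module.
\<close>

lemma irreducible_iff_transitive:
  "irreducible_module iD M \<longleftrightarrow> carrier M \<noteq> {\<zero>\<^bsub>M\<^esub>} \<and>
    (\<forall>v\<in>carrier M. v \<noteq> \<zero>\<^bsub>M\<^esub> \<longrightarrow> (\<forall>w\<in>carrier M. \<exists>x. w = act x v))"
proof
  assume irr: "irreducible_module iD M"
  have "\<exists>x. w = act x v" if v: "v \<in> carrier M" "v \<noteq> \<zero>\<^bsub>M\<^esub>" and w: "w \<in> carrier M" for v w
  proof -
    let ?H = "range (\<lambda>x. act x v)"
    have "submodule ?H iD M"
      unfolding submodule_iff
    proof (intro conjI ballI allI)
      show "?H \<subseteq> carrier M" using v by auto
      show "\<zero>\<^bsub>M\<^esub> \<in> ?H" using act_zero_left[OF v(1)] by (metis rangeI)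
      show "w \<oplus>\<^bsub>M\<^esub> w' \<in> ?H" if "w \<in> ?H" "w' \<in> ?H" for w w'
        using that by (auto simp flip: act_plus[OF v(1)])
      show "act x w \<in> ?H" if "w \<in> ?H" for x w
        using that by (auto simp flip: act_times[OF v(1)])
    qed
    moreover have "v \<in> ?H" using act_one[OF v(1)] by (metis rangeI)
    ultimately have "?H = carrier M" using irr v unfolding irreducible_module_def by blast
    thus ?thesis using w by blast
  qed
  thus "carrier M \<noteq> {\<zero>\<^bsub>M\<^esub>} \<and>
    (\<forall>v\<in>carrier M. v \<noteq> \<zero>\<^bsub>M\<^esub> \<longrightarrow> (\<forall>w\<in>carrier M. \<exists>x. w = act x v))"
    using irr unfolding irreducible_module_def by blast
next
  assume *: "carrier M \<noteq> {\<zero>\<^bsub>M\<^esub>} \<and>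
    (\<forall>v\<in>carrier M. v \<noteq> \<zero>\<^bsub>M\<^esub> \<longrightarrow> (\<forall>w\<in>carrier M. \<exists>x. w = act x v))"
  show "irreducible_module iD M"
    unfolding irreducible_module_def
  proof (intro conjI allI impI)
    show "left_module iD M" by unfold_locales
    show "carrier M \<noteq> {\<zero>\<^bsub>M\<^esub>}" using * by blast
    fix H assume H: "submodule H iD M"
    show "H = {\<zero>\<^bsub>M\<^esub>} \<or> H = carrier M"
    proof (cases "H = {\<zero>\<^bsub>M\<^esub>}")
      case False
      then obtain v where v: "v \<in> H" "v \<noteq> \<zero>\<^bsub>M\<^esub>" using H unfolding submodule_iff by blast
      have "w \<in> H" if "w \<in> carrier M" for w
      proof -
        have "\<exists>x. w = act x v" using * v H that unfolding submodule_iff by (meson subsetD)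
        thus ?thesis using H v unfolding submodule_iff by blast
      qed
      thus ?thesis using H unfolding submodule_iff by blast
    qed simp
  qed
qed

end

section \<open>Schur's lemma\<close>

text \<open>
  An irreducible module is \<open>iD\<^sub>\<infinity>\<close> modulo the annihilator of any nonzero vector, and this annihilator is a
  maximal left ideal. An inclusion of two such annihilators is therefore an equality, and
  \<open>x u \<mapsto> x e\<close> is an isomorphism.
\<close>

lemma isomorphic_if_annihilator_subset:
  fixes M :: "(free_alg set, 'v) module" and N :: "(free_alg set, 'w) module"
  assumes M: "irreducible_module iD M" and N: "irreducible_module iD N"
    and u: "u \<in> carrier M" "u \<noteq> \<zero>\<^bsub>M\<^esub>" and e: "e \<in> carrier N"
    and ann: "\<And>x. iD_module.act N x e = \<zero>\<^bsub>N\<^esub> \<Longrightarrow> iD_module.act M x u = \<zero>\<^bsub>M\<^esub>"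
  shows "module_isomorphic iD M N"
proof -
  interpret M: iD_module M using M by (simp add: irreducible_module_def iD_module_def)
  interpret N: iD_module N using N by (simp add: irreducible_module_def iD_module_def)
  have "e \<noteq> \<zero>\<^bsub>N\<^esub>"
    using ann[of 1] u e by auto
  \<comment> \<open>Maximality: if \<open>x e \<noteq> 0\<close> then \<open>y x e = e\<close> for some \<open>y\<close>, so \<open>1 - y x\<close> kills \<open>e\<close>, hence \<open>u\<close>.\<close>
  have ann': "N.act x e = \<zero>\<^bsub>N\<^esub>" if x: "M.act x u = \<zero>\<^bsub>M\<^esub>" for x
  proof (rule ccontr)
    assume "N.act x e \<noteq> \<zero>\<^bsub>N\<^esub>"
    then obtain y where y: "e = N.act y (N.act x e)"
      using N[unfolded N.irreducible_iff_transitive] e by (meson N.act_closed)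
    hence "N.act (1 - y * x) e = \<zero>\<^bsub>N\<^esub>"
      using e by (intro N.act_diff_zero) (simp_all add: N.act_times)
    hence "M.act 1 u = M.act (y * x) u"
      using u by (intro M.act_eqI ann)
    thus False using u x by (simp add: M.act_times)
  qed
  have eq: "M.act x u = M.act y u \<longleftrightarrow> N.act x e = N.act y e" for x y
    using M.act_eqI M.act_diff_zero N.act_eqI N.act_diff_zero ann ann' u(1) e by metis
  define \<phi> where "\<phi> w = N.act (SOME x. w = M.act x u) e" for w
  have \<phi>: "\<phi> (M.act x u) = N.act x e" for x
    unfolding \<phi>_def using someI[of "\<lambda>y. M.act x u = M.act y u" x] eq by metis
  have gen_M: "carrier M = range (\<lambda>x. M.act x u)"
    using M[unfolded M.irreducible_iff_transitive] u M.act_closed by (auto simp: image_iff)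
  have gen_N: "carrier N = range (\<lambda>x. N.act x e)"
    using N[unfolded N.irreducible_iff_transitive] e \<open>e \<noteq> \<zero>\<^bsub>N\<^esub>\<close> by (auto simp: image_iff)
  have "bij_betw \<phi> (carrier M) (carrier N)"
    unfolding gen_M gen_N bij_betw_def inj_on_def by (auto simp: \<phi> eq image_image)
  moreover have "\<phi> (v \<oplus>\<^bsub>M\<^esub> w) = \<phi> v \<oplus>\<^bsub>N\<^esub> \<phi> w" if vw: "v \<in> carrier M" "w \<in> carrier M" for v w
  proof -
    obtain x y where "v = M.act x u" "w = M.act y u" using vw unfolding gen_M by blast
    moreover have "\<phi> (M.act x u \<oplus>\<^bsub>M\<^esub> M.act y u) = N.act (x + y) e"
      by (simp only: \<phi> M.act_plus[OF u(1), symmetric])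
    ultimately show ?thesis using e by (simp add: \<phi> N.act_plus)
  qed
  moreover have "\<phi> (U \<odot>\<^bsub>M\<^esub> v) = U \<odot>\<^bsub>N\<^esub> \<phi> v" if U: "U \<in> carrier iD" and v: "v \<in> carrier M" for U v
  proof -
    obtain x where x: "U = iD_class x" using U unfolding iD_carrier by blast
    obtain y where y: "v = M.act y u" using v gen_M by blast
    have "\<phi> (M.act x v) = N.act x (\<phi> v)"
      using u e by (simp add: y \<phi> N.act_times flip: M.act_times)
    thus ?thesis by (simp add: x M.act_def N.act_def)
  qed
  ultimately show ?thesis unfolding module_isomorphic_def by blast
qed

section \<open>A polynomial in \<open>a\<close> killing a given vector\<close>

text \<open>
  Gaussian elimination, as an induction on the equations of a homogeneous system: an unknown \<open>j\<close> with
  nonzero coefficient in the new equation is expressed by the others.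
\<close>

lemma linear_dependence:
  fixes C :: "'i \<Rightarrow> 'u \<Rightarrow> real"
  assumes "finite S" "finite I" "card S < card I"
  shows "\<exists>d. (\<exists>i\<in>I. d i \<noteq> 0) \<and> (\<forall>u\<in>S. (\<Sum>i\<in>I. d i * C i u) = 0)"
  using assms
proof (induction S arbitrary: I C rule: finite_induct)
  case empty
  hence "I \<noteq> {}" by auto
  thus ?case by (intro exI[of _ "\<lambda>_. 1"]) auto
next
  case (insert s S)
  show ?case
  proof (cases "\<forall>i\<in>I. C i s = 0")
    case True
    have "card S < card I" using insert.prems insert.hyps by simp
    from insert.IH[OF insert.prems(1) this, of C] True show ?thesis by auto
  next
    case False
    then obtain j where j: "j \<in> I" "C j s \<noteq> 0" by blast
    define C' where "C' i u = C i u - C i s / C j s * C j u" for i u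
    have "card S < card (I - {j})" using insert.prems insert.hyps j by simp
    then obtain d where d: "\<exists>i\<in>I - {j}. d i \<noteq> 0"
      "\<forall>u\<in>S. (\<Sum>i\<in>I - {j}. d i * C' i u) = 0"
      using insert.IH[of "I - {j}" C'] insert.prems by auto
    define t where "t = (\<Sum>i\<in>I - {j}. d i * C i s / C j s)"
    define d' where "d' = d(j := - t)"
    have sum: "(\<Sum>i\<in>I. d' i * C i u) = (\<Sum>i\<in>I - {j}. d i * C' i u)" for u
    proof -
      have "(\<Sum>i\<in>I. d' i * C i u) = - t * C j u + (\<Sum>i\<in>I - {j}. d' i * C i u)"
        using insert.prems(1) j(1) by (simp add: sum.remove[of I j] d'_def)
      also have "(\<Sum>i\<in>I - {j}. d' i * C i u) = (\<Sum>i\<in>I - {j}. d i * C i u)"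
        by (intro sum.cong) (auto simp: d'_def)
      finally show ?thesis
        by (simp add: C'_def t_def sum_subtractf sum_distrib_left sum_distrib_right algebra_simps)
    qed
    have "C' i s = 0" for i using j(2) by (simp add: C'_def)
    hence "\<forall>u\<in>insert s S. (\<Sum>i\<in>I. d' i * C i u) = 0" using d(2) by (simp add: sum)
    moreover have "\<exists>i\<in>I. d' i \<noteq> 0" using d(1) by (auto simp: d'_def)
    ultimately show ?thesis by blast
  qed
qed

context iD_module
begin

definition real_comb :: "'v set \<Rightarrow> ('v \<Rightarrow> real) \<Rightarrow> 'v"
  where "real_comb S c = (\<Oplus>\<^bsub>M\<^esub>u\<in>S. act (Poly_Mapping.single 0 (c u)) u)"

lemma finite_dimensional_rep_iff:
  "finite_dimensional_rep M \<longleftrightarrow>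
    (\<exists>S. finite S \<and> S \<subseteq> carrier M \<and> (\<forall>v\<in>carrier M. \<exists>c. v = real_comb S c))"
  by (simp add: finite_dimensional_rep_def real_comb_def act_def iD_scalar_def)

lemma real_comb_cong: "(\<And>u. u \<in> S \<Longrightarrow> c u = d u) \<Longrightarrow> S \<subseteq> carrier M \<Longrightarrow> real_comb S c = real_comb S d"
  unfolding real_comb_def by (rule M.finsum_cong') auto

lemma real_comb_zero: "S \<subseteq> carrier M \<Longrightarrow> real_comb S (\<lambda>_. 0) = \<zero>\<^bsub>M\<^esub>"
  unfolding real_comb_def by (rule M.add.finprod_one_eqI) auto

lemma real_comb_add:
  "S \<subseteq> carrier M \<Longrightarrow> real_comb S (\<lambda>u. c u + d u) = real_comb S c \<oplus>\<^bsub>M\<^esub> real_comb S d"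
  unfolding real_comb_def
  by (subst M.finsum_addf[symmetric])
    (auto intro!: M.finsum_cong' simp: Poly_Mapping.single_add act_plus)

lemma real_comb_scale:
  assumes "finite S" "S \<subseteq> carrier M"
  shows "real_comb S (\<lambda>u. r * c u) = act (Poly_Mapping.single 0 r) (real_comb S c)"
  using assms
proof (induction S rule: finite_induct)
  case (insert s S)
  have "Poly_Mapping.single 0 (r * t) = Poly_Mapping.single 0 r * (Poly_Mapping.single 0 t :: free_alg)" for t
    by (simp add: Poly_Mapping.mult_single)
  moreover have "real_comb (insert s S) f = act (Poly_Mapping.single 0 (f s)) s \<oplus>\<^bsub>M\<^esub> real_comb S f" for f
    using insert unfolding real_comb_def by (intro M.finsum_insert) auto
  moreover have "real_comb S c \<in> carrier M"
    using insert unfolding real_comb_def by (intro M.finsum_closed) auto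
  ultimately show ?case
    using insert by (simp add: act_add act_times)
qed (simp add: real_comb_def)

lemma real_comb_in_span:
  assumes "finite S" "S \<subseteq> carrier M" "s \<in> S"
  shows "\<exists>c. act (Poly_Mapping.single 0 r) s = real_comb S c"
proof
  have "real_comb S (\<lambda>u. if u = s then r else 0) =
      (\<Oplus>\<^bsub>M\<^esub>u\<in>S. if s = u then act (Poly_Mapping.single 0 r) u else \<zero>\<^bsub>M\<^esub>)"
    unfolding real_comb_def using assms by (intro M.finsum_cong') auto
  also have "\<dots> = act (Poly_Mapping.single 0 r) s"
    using assms by (intro M.add.finprod_singleton) auto
  finally show "act (Poly_Mapping.single 0 r) s = real_comb S (\<lambda>u. if u = s then r else 0)" ..
qed

text \<open>
  The coefficients of \<open>q\<close> are those of a linear relation among the vectors \<open>v, a v, a\<^sup>2 v, \<dots>\<close>.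
\<close>

lemma polynomial_annihilator:
  assumes fd: "finite_dimensional_rep M" and v: "v \<in> carrier M"
  shows "\<exists>q. q \<noteq> 0 \<and> act (at_a q) v = \<zero>\<^bsub>M\<^esub>"
proof -
  obtain S where S: "finite S" "S \<subseteq> carrier M" "\<And>v. v \<in> carrier M \<Longrightarrow> \<exists>c. v = real_comb S c"
    using fd unfolding finite_dimensional_rep_iff by blast
  have "\<exists>c. act (at_a (Polynomial.monom 1 i)) v = real_comb S c" for i :: nat
    using S(3) v by simp
  then obtain C where C: "act (at_a (Polynomial.monom 1 i)) v = real_comb S (C i)" for i :: nat
    by metis
  obtain d where d: "\<exists>i\<in>{..card S}. d i \<noteq> 0" "\<forall>u\<in>S. (\<Sum>i\<le>card S. d i * C i u) = 0"
    using linear_dependence[OF S(1), of "{..card S}" C] by auto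
  have comb: "act (at_a (\<Sum>i\<in>I. smult (d i) (Polynomial.monom 1 i))) v = real_comb S (\<lambda>u. \<Sum>i\<in>I. d i * C i u)"
    if "finite I" for I
    using that
  proof (induction I rule: finite_induct)
    case (insert i I)
    thus ?case
      using v S by (simp add: at_a_add at_a_smult act_plus act_times C real_comb_add real_comb_scale
          del: smult_monom)
  qed (use v S in \<open>simp add: real_comb_zero\<close>)
  let ?q = "\<Sum>i\<le>card S. smult (d i) (Polynomial.monom 1 i)"
  have "act (at_a ?q) v = \<zero>\<^bsub>M\<^esub>"
    using comb[of "{..card S}"] real_comb_cong[of S _ "\<lambda>_. 0"] real_comb_zero d(2) S(2) by simp
  moreover have "?q \<noteq> 0"
  proof -
    obtain i where i: "i \<le> card S" "d i \<noteq> 0" using d(1) by auto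
    have "Polynomial.coeff ?q i = d i" using i(1) by (simp add: coeff_sum if_distrib sum.delta' cong: if_cong)
    thus ?thesis using i(2) by (metis coeff_0)
  qed
  ultimately show ?thesis by blast
qed

end

section \<open>Minimal polynomials over \<open>\<real>\<close> of complex numbers\<close>

definition real_min_poly :: "complex \<Rightarrow> real poly"
  where "real_min_poly c = (if c \<in> \<real> then [:- Re c, 1:] else [:(Re c)\<^sup>2 + (Im c)\<^sup>2, - 2 * Re c, 1:])"

abbreviation eval_at :: "complex \<Rightarrow> real poly \<Rightarrow> complex"
  where "eval_at c f \<equiv> poly (map_poly complex_of_real f) c"

lemma eval_at_simps [simp]:
  "eval_at c (f + g) = eval_at c f + eval_at c g"
  "eval_at c (f - g) = eval_at c f - eval_at c g"
  "eval_at c (f * g) = eval_at c f * eval_at c g"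
  "eval_at c (- f) = - eval_at c f"
  "eval_at c (pCons r f) = complex_of_real r + c * eval_at c f"
proof -
  have "map_poly complex_of_real (f + g) = map_poly complex_of_real f + map_poly complex_of_real g" for f g
    by (rule poly_eqI) (simp add: coeff_map_poly)
  thus add: "eval_at c (f + g) = eval_at c f + eval_at c g" for f g
    by simp
  show pCons: "eval_at c (pCons r f) = complex_of_real r + c * eval_at c f" for r f
    by (simp add: map_poly_pCons)
  have smult: "eval_at c (smult r f) = complex_of_real r * eval_at c f" for r f
    by (induction f) (simp_all add: pCons algebra_simps)
  show "eval_at c (f * g) = eval_at c f * eval_at c g"
    by (induction f) (simp_all add: add smult pCons algebra_simps)
  show uminus: "eval_at c (- f) = - eval_at c f" for f
    using smult[of "-1" f] by simp
  show "eval_at c (f - g) = eval_at c f - eval_at c g"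
    using add[of f "- g"] uminus[of g] by simp
qed

lemma eval_at_1 [simp]: "eval_at c 1 = 1"
  by (simp add: one_pCons)

lemma eval_at_cnj: "eval_at (cnj c) f = cnj (eval_at c f)"
  by (induction f) simp_all

lemma eval_at_pcompose: "eval_at c (pcompose f g) = eval_at (eval_at c g) f"
  by (induction f) (simp_all add: pcompose_pCons)

text \<open>
  For real \<open>c\<close> the two alternatives coincide, so the real and the nonreal case can be treated alike.
\<close>

lemma eval_at_real_min_poly: "eval_at z (real_min_poly c) = 0 \<longleftrightarrow> z = c \<or> z = cnj c"
proof (cases "c \<in> \<real>")
  case True
  thus ?thesis by (auto simp: real_min_poly_def complex_eq_iff complex_is_Real_iff)
next
  case False
  have "eval_at z (real_min_poly c) = (z - c) * (z - cnj c)"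
    using False by (auto simp: real_min_poly_def complex_eq_iff power2_eq_square algebra_simps)
  thus ?thesis by simp
qed

lemma degree_le_1E:
  assumes "degree f \<le> 1"
  obtains x y where "f = [:x, y:]"
proof -
  have "f = [:coeff f 0, coeff f 1:]"
    using assms by (intro poly_eqI) (auto simp: coeff_pCons coeff_eq_0 split: nat.split)
  thus ?thesis using that by blast
qed

lemma real_min_poly_dvd_iff: "real_min_poly c dvd f \<longleftrightarrow> eval_at c f = 0"
proof
  assume "real_min_poly c dvd f"
  thus "eval_at c f = 0" using eval_at_real_min_poly[of c c] by (auto elim!: dvdE)
next
  assume f: "eval_at c f = 0"
  define g where "g = f mod real_min_poly c"
  have ne: "real_min_poly c \<noteq> 0" by (simp add: real_min_poly_def)
  have "eval_at c f = eval_at c (f div real_min_poly c) * eval_at c (real_min_poly c) + eval_at c g"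
    unfolding g_def eval_at_simps[symmetric] by simp
  hence g0: "eval_at c g = 0" using f eval_at_real_min_poly[of c c] by simp
  have deg: "g = 0 \<or> degree g < degree (real_min_poly c)"
    unfolding g_def using degree_mod_less ne by blast
  have "g = 0"
  proof (cases "c \<in> \<real>")
    case True
    hence "degree g = 0" using deg by (auto simp: real_min_poly_def)
    then obtain x where "g = [:x:]" by (metis degree_eq_zeroE)
    thus ?thesis using g0 by simp
  next
    case False
    hence "degree g \<le> 1" using deg by (auto simp: real_min_poly_def)
    then obtain x y where g: "g = [:x, y:]" by (rule degree_le_1E)
    hence "y = 0" "x = 0"
      using g0 False by (auto simp: complex_eq_iff complex_is_Real_iff)
    thus ?thesis using g by simp
  qed
  thus "real_min_poly c dvd f" unfolding g_def by (simp add: mod_eq_0_iff_dvd)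
qed

text \<open>
  The elements \<open>1\<close> and \<open>c\<close> span \<open>\<complex>\<close> over \<open>\<real>\<close> when \<open>c\<close> is not real.
\<close>

lemma eval_at_surj:
  assumes "c \<in> \<real> \<Longrightarrow> z \<in> \<real>"
  shows "\<exists>f. eval_at c f = z"
proof (cases "c \<in> \<real>")
  case True
  hence "eval_at c [:Re z:] = z" using assms by (simp add: complex_eq_iff complex_is_Real_iff)
  thus ?thesis by blast
next
  case False
  hence "Im c \<noteq> 0" by (simp add: complex_is_Real_iff)
  hence "eval_at c [:Re z - Re c * Im z / Im c, Im z / Im c:] = z"
    by (simp add: complex_eq_iff field_simps)
  thus ?thesis by blast
qed

lemma eval_at_real: "c \<in> \<real> \<Longrightarrow> eval_at c f \<in> \<real>"
  by (induction f) auto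

text \<open>
  The ring \<open>\<real>[t]/(p)\<close> is a field for \<open>p\<close> the minimal polynomial of \<open>c\<close>, because evaluation at \<open>c\<close>
  identifies it with the subfield \<open>\<real>(c)\<close> of \<open>\<complex>\<close>.
\<close>

lemma inverse_mod_real_min_poly:
  assumes "\<not> real_min_poly c dvd f"
  shows "\<exists>g. real_min_poly c dvd g * f - 1"
proof -
  obtain g where "eval_at c g = inverse (eval_at c f)"
    using eval_at_surj[of c "inverse (eval_at c f)"] eval_at_real by auto
  thus ?thesis using assms by (auto simp: real_min_poly_dvd_iff one_pCons intro!: exI[of _ g])
qed

lemma admissible_iff: "admissible p \<longleftrightarrow> (\<exists>c. c \<noteq> 0 \<and> p = real_min_poly c)"
proof
  assume "admissible p"
  thus "\<exists>c. c \<noteq> 0 \<and> p = real_min_poly c"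
    unfolding admissible_def
  proof (elim disjE exE conjE)
    fix r :: real assume "r \<noteq> 0" "p = [:- r, 1:]"
    thus ?thesis by (intro exI[of _ "complex_of_real r"]) (simp add: real_min_poly_def)
  next
    fix c assume c: "c \<notin> \<real>" and p: "map_poly complex_of_real p = [:- c, 1:] * [:- cnj c, 1:]"
    have "map_poly complex_of_real (real_min_poly c) = [:- c, 1:] * [:- cnj c, 1:]"
      using c by (simp add: real_min_poly_def map_poly_pCons complex_eq_iff power2_eq_square)
    hence "p = real_min_poly c"
      using p by (metis (no_types, lifting) coeff_map_poly of_real_0 of_real_eq_iff poly_eqI)
    moreover have "c \<noteq> 0" using c by auto
    ultimately show ?thesis by blast
  qed
next
  assume "\<exists>c. c \<noteq> 0 \<and> p = real_min_poly c"
  then obtain c where c: "c \<noteq> 0" "p = real_min_poly c" by blast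
  show "admissible p"
  proof (cases "c \<in> \<real>")
    case True
    hence "Re c \<noteq> 0 \<and> p = [:- Re c, 1:]"
      using c by (auto simp: real_min_poly_def complex_eq_iff complex_is_Real_iff)
    thus ?thesis unfolding admissible_def by blast
  next
    case False
    hence "map_poly complex_of_real p = [:- c, 1:] * [:- cnj c, 1:]"
      using c by (simp add: real_min_poly_def map_poly_pCons complex_eq_iff power2_eq_square)
    thus ?thesis using False unfolding admissible_def by blast
  qed
qed

lemma complex_root_exists:
  assumes "degree q > 0"
  shows "\<exists>c. eval_at c q = 0"
proof -
  have "degree (map_poly complex_of_real q) = degree q" by (simp add: degree_map_poly)
  hence "\<not> constant (poly (map_poly complex_of_real q))"
    using assms by (simp add: constant_degree)
  thus ?thesis by (rule fundamental_theorem_of_algebra)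
qed

section \<open>A vector killed by a minimal polynomial\<close>

text \<open>
  Among the nonzero polynomials \<open>q\<close> such that \<open>q(a)\<close> kills some nonzero vector take one of least degree.
  It has a complex root \<open>c\<close>; let \<open>p\<close> be its minimal polynomial over \<open>\<real>\<close> and \<open>q = p k\<close>. By minimality
  \<open>k(a)\<close> does not kill the vector, and its image under \<open>k(a)\<close> is killed by \<open>p(a)\<close>. Finally \<open>c \<noteq> 0\<close>, since
  \<open>a\<close> is invertible.
\<close>

lemma (in iD_module) minimal_polynomial_vector:
  assumes fd: "finite_dimensional_rep M" and ne: "carrier M \<noteq> {\<zero>\<^bsub>M\<^esub>}"
  shows "\<exists>c w. c \<noteq> 0 \<and> w \<in> carrier M \<and> w \<noteq> \<zero>\<^bsub>M\<^esub> \<and> act (at_a (real_min_poly c)) w = \<zero>\<^bsub>M\<^esub>"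
proof -
  define P where "P q \<longleftrightarrow> q \<noteq> 0 \<and> (\<exists>w\<in>carrier M. w \<noteq> \<zero>\<^bsub>M\<^esub> \<and> act (at_a q) w = \<zero>\<^bsub>M\<^esub>)" for q
  obtain v where "v \<in> carrier M" "v \<noteq> \<zero>\<^bsub>M\<^esub>" using ne M.zero_closed by blast
  hence "\<exists>q. P q" using polynomial_annihilator[OF fd] unfolding P_def by blast
  then obtain q where q: "P q" and min: "\<And>q'. P q' \<Longrightarrow> degree q \<le> degree q'"
    using ex_has_least_nat[of P _ degree] by metis
  obtain w where w: "w \<in> carrier M" "w \<noteq> \<zero>\<^bsub>M\<^esub>" "act (at_a q) w = \<zero>\<^bsub>M\<^esub>" and "q \<noteq> 0"
    using q unfolding P_def by blast
  have "degree q > 0"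
  proof (rule ccontr)
    assume "\<not> degree q > 0"
    then obtain x where x: "q = [:x:]" by (metis degree_eq_zeroE neq0_conv)
    hence "x \<noteq> 0" using \<open>q \<noteq> 0\<close> by simp
    hence "at_a [:1 / x:] * at_a q = 1" by (simp add: x Poly_Mapping.mult_single)
    hence "act 1 w = \<zero>\<^bsub>M\<^esub>" using w by (metis act_times act_zero_right)
    thus False using w by simp
  qed
  then obtain c where "eval_at c q = 0" using complex_root_exists by blast
  then obtain k where k: "q = real_min_poly c * k"
    unfolding real_min_poly_dvd_iff[symmetric] by (auto elim: dvdE)
  define u where "u = act (at_a k) w"
  have u: "u \<in> carrier M" "act (at_a (real_min_poly c)) u = \<zero>\<^bsub>M\<^esub>"
    using w by (simp_all add: u_def k at_a_mult act_times)
  have "real_min_poly c \<noteq> 0" "degree (real_min_poly c) > 0" "k \<noteq> 0"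
    using \<open>q \<noteq> 0\<close> k by (auto simp: real_min_poly_def)
  hence "degree k < degree q" by (simp add: k degree_mult_eq)
  hence "u \<noteq> \<zero>\<^bsub>M\<^esub>" using min[of k] w \<open>k \<noteq> 0\<close> unfolding P_def u_def by fastforce
  moreover have "c \<noteq> 0"
  proof
    assume "c = 0"
    hence "act (gen Ga) u = \<zero>\<^bsub>M\<^esub>" using u by (simp add: real_min_poly_def)
    moreover have "act (gen Ga_inv * gen Ga) u = act 1 u"
      using u by (intro act_eqI act_relation_ideal relation_consequences)
    ultimately show False using u \<open>u \<noteq> \<zero>\<^bsub>M\<^esub>\<close> by (simp add: act_times)
  qed
  ultimately show ?thesis using u by blast
qed

section \<open>The modules \<open>\<real>[t]/(p) \<oplus> b \<real>[t]/(p)\<close>\<close>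

lemma Rtmod_carrier: "carrier (Rtmod p) = range (Rtmod_class p)"
  by (auto simp: Rtmod_def Rtmod_class_def FactRing_def A_RCOSETS_def')

lemma Rtmod_class_uminus: "Rtmod_class p (- f) = \<ominus>\<^bsub>Rtmod p\<^esub> Rtmod_class p f"
proof -
  interpret H: ring_hom_ring Rt "Rtmod p" "Rtmod_class p" by (rule Rtmod_class_ring_hom)
  show ?thesis using H.hom_a_inv[of f] by simp
qed

text \<open>
  The polynomial \<open>s\<close> represents \<open>t\<^sup>-\<^sup>1\<close> in \<open>\<real>[t]/(p)\<close>.
\<close>

locale t_invertible =
  fixes p s :: "real poly"
  assumes s: "p dvd s * [:0, 1:] - 1"
begin

lemma p0: "poly p 0 \<noteq> 0"
proof
  assume "poly p 0 = 0"
  moreover obtain k where "s * [:0, 1:] - 1 = p * k" using s by (auto elim: dvdE)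
  hence "poly (s * [:0, 1:] - 1) 0 = poly p 0 * poly k 0" by (simp only: poly_mult)
  ultimately show False by simp
qed

sublocale V: iD_module "V_rep p"
  by (rule iD_module.intro, rule V_rep_left_module, rule p0)

text \<open>
  The element \<open>F + b G\<close>. Computing with representatives reduces every identity in the module to
  divisibility by \<open>p\<close>.
\<close>

definition V_elt :: "real poly \<Rightarrow> real poly \<Rightarrow> real poly set \<times> real poly set"
  where "V_elt F G = (Rtmod_class p F, Rtmod_class p G)"

lemma V_carrier: "carrier (V_rep p) = {V_elt F G | F G. True}"
  by (auto simp: V_rep_simps V_elt_def Rtmod_carrier)

lemma V_elt_closed [simp]: "V_elt F G \<in> carrier (V_rep p)"
  unfolding V_carrier by blast

lemma V_elt_eq_iff: "V_elt F G = V_elt F' G' \<longleftrightarrow> p dvd F - F' \<and> p dvd G - G'"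
  by (simp add: V_elt_def Rtmod_class_eq_iff)

lemma V_zero: "\<zero>\<^bsub>V_rep p\<^esub> = V_elt 0 0"
  by (simp add: V_rep_simps V_elt_def Rtmod_class_zero)

lemma V_add: "V_elt F G \<oplus>\<^bsub>V_rep p\<^esub> V_elt F' G' = V_elt (F + F') (G + G')"
  by (simp add: V_rep_simps V_elt_def Rtmod_class_add)

lemma act_scalar: "V.act (Poly_Mapping.single 0 r) (V_elt F G) = V_elt (smult r F) (smult r G)"
  using V_rep_action(3)[OF p0 Rtmod_class_closed Rtmod_class_closed, of r F G]
  by (simp add: V.act_def iD_scalar_def V_elt_def flip: Rtmod_class_mult)

lemma class_s: "inv\<^bsub>Rtmod p\<^esub> Rtmod_class p [:0, 1:] = Rtmod_class p s"
proof -
  interpret T: cring "Rtmod p" by (rule Rtmod_cring)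
  have "Rtmod_class p (s * [:0, 1:]) = Rtmod_class p 1"
    using s by (simp only: Rtmod_class_eq_iff)
  hence "Rtmod_class p s \<otimes>\<^bsub>Rtmod p\<^esub> Rtmod_class p [:0, 1:] = \<one>\<^bsub>Rtmod p\<^esub>"
    by (simp only: Rtmod_class_mult Rtmod_class_one)
  thus ?thesis
    by (intro T.inv_unique'[symmetric] Rtmod_class_closed) (simp_all add: T.m_comm Rtmod_class_closed)
qed

lemma act_a: "V.act (gen Ga) (V_elt F G) = V_elt ([:0, 1:] * F) (s * G)"
  using V_rep_action(1)[OF p0 Rtmod_class_closed Rtmod_class_closed, of F G]
  by (simp only: V.act_def iD_a_def V_elt_def class_s Rtmod_class_mult)

lemma act_b: "V.act (gen Gb) (V_elt F G) = V_elt (- G) F"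
  using V_rep_action(2)[OF p0 Rtmod_class_closed Rtmod_class_closed, of F G]
  by (simp only: V.act_def iD_b_def V_elt_def Rtmod_class_uminus)

text \<open>
  On the second component \<open>a\<close> acts as \<open>t\<^sup>-\<^sup>1\<close>, so \<open>q(a)\<close> acts there as \<open>q(t\<^sup>-\<^sup>1)\<close>.
\<close>

lemma act_at_a: "V.act (at_a q) (V_elt F G) = V_elt (q * F) (pcompose q s * G)"
proof (induction q)
  case 0
  show ?case using V.act_zero_left[of "V_elt F G"] by (simp add: V_zero)
next
  case (pCons r q)
  have "V.act (at_a (pCons r q)) (V_elt F G) =
      V_elt (smult r F + [:0, 1:] * (q * F)) (smult r G + s * (pcompose q s * G))"
    by (simp only: at_a_pCons V.act_plus V.act_times V_elt_closed pCons.IH act_a act_scalar V_add)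
  thus ?case by (simp add: pcompose_pCons algebra_simps)
qed

lemma act_normal_form: "V.act (normal_form F G) (V_elt 1 0) = V_elt F G"
  unfolding normal_form_def
  by (simp add: V.act_plus V.act_times act_at_a act_b V_add)

text \<open>
  The module is \<open>iD\<^sub>\<infinity>\<close> modulo the left ideal generated by \<open>p(a)\<close>: an element that kills the generator has
  a normal form \<open>F(a) + b G(a)\<close>, which sends the generator to \<open>F + b G\<close>, so \<open>p\<close> divides \<open>F\<close> and \<open>G\<close>.
\<close>

lemma annihilator_of_generator:
  assumes "V.act x (V_elt 1 0) = \<zero>\<^bsub>V_rep p\<^esub>"
  shows "x \<in> left_multiples p"
proof -
  obtain F G where FG: "x - normal_form F G \<in> left_multiples p"
    using normal_form_exists[OF s] by blast
  have p: "V.act (at_a p) (V_elt 1 0) = \<zero>\<^bsub>V_rep p\<^esub>"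
    by (simp add: act_at_a V_zero V_elt_eq_iff)
  hence "V.act x (V_elt 1 0) = V.act (normal_form F G) (V_elt 1 0)"
    by (intro V.act_eqI V.act_left_multiples[OF _ p FG] V_elt_closed)
  hence "V_elt F G = V_elt 0 0" using assms by (simp add: act_normal_form V_zero)
  hence "p dvd F" "p dvd G" by (simp_all add: V_elt_eq_iff)
  from left_multiples_add[OF FG normal_form_in_left_multiples[OF this]] show ?thesis by simp
qed

end

text \<open>
  This is the heart of irreducibility. A submodule containing \<open>1 + b H\<close> contains
  \<open>b (1 + b H) - q(a) (1 + b H) = - (H + q) + b (1 - q(t\<^sup>-\<^sup>1) H)\<close>, and the claim is that for some
  representative \<open>q\<close> of \<open>- H\<close> this is a nonzero element of the second summand. Otherwise
  \<open>q(c\<^sup>-\<^sup>1) H(c) = 1\<close> for all representatives. Comparing \<open>- H\<close> with \<open>p - H\<close> gives \<open>p(c\<^sup>-\<^sup>1) = 0\<close>, so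
  \<open>c\<^sup>-\<^sup>1\<close> is the conjugate of \<open>c\<close> and \<open>H(c\<^sup>-\<^sup>1)\<close> is the conjugate of \<open>H(c)\<close>. Then \<open>\<bar>H(c)\<bar>\<^sup>2 = - 1\<close>, which
  is absurd.
\<close>

lemma (in t_invertible) quaternionic_obstruction:
  assumes c: "c \<noteq> 0" "p = real_min_poly c"
  shows "\<exists>q. p dvd q + H \<and> \<not> p dvd 1 - pcompose q s * H"
proof (rule ccontr)
  assume "\<not> ?thesis"
  hence all: "p dvd 1 - pcompose q s * H" if "p dvd q + H" for q
    using that by blast
  have "eval_at c (s * [:0, 1:] - 1) = 0"
    using s unfolding c(2) real_min_poly_dvd_iff .
  hence sc: "eval_at c s = inverse c"
    using c(1) by (simp add: field_simps)
  have eq: "eval_at (inverse c) q * eval_at c H = 1" if "p dvd q + H" for q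
    using all[OF that] unfolding c(2) real_min_poly_dvd_iff by (simp add: eval_at_pcompose sc)
  have 1: "eval_at (inverse c) H * eval_at c H = -1"
    using eq[of "- H"] by (simp add: minus_equation_iff[of "_ * _"])
  have "eval_at (inverse c) (p - H) * eval_at c H = 1"
    by (rule eq) simp
  with 1 have "eval_at (inverse c) p = 0" by (auto simp: algebra_simps)
  hence "inverse c = c \<or> inverse c = cnj c"
    unfolding c(2) eval_at_real_min_poly .
  moreover have "cnj c = c" if "inverse c = c"
  proof -
    have "c\<^sup>2 = 1" using that c(1) by (metis power2_eq_square right_inverse)
    hence "c = 1 \<or> c = -1" by (simp add: power2_eq_1_iff)
    thus ?thesis by auto
  qed
  ultimately have "inverse c = cnj c" by metis
  hence "cnj (eval_at c H) * eval_at c H = -1"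
    using 1 by (simp add: eval_at_cnj)
  hence "Re (cnj (eval_at c H) * eval_at c H) = -1" by simp
  moreover have "Re (cnj (eval_at c H) * eval_at c H) \<ge> 0" by simp
  ultimately show False by linarith
qed

text \<open>
  From a nonzero vector the algebra reaches the generator \<open>1\<close>: applying \<open>b\<close> if necessary, the first
  component is nonzero, and dividing by it gives a vector \<open>1 + b H\<close>. The previous lemma leads to a
  nonzero vector \<open>b U\<close>, then \<open>b\<close> moves it to the first summand, where division by \<open>- U\<close> gives \<open>1\<close>.
\<close>

lemma (in t_invertible) irreducible_V_rep:
  assumes c: "c \<noteq> 0" "p = real_min_poly c"
  shows "irreducible_module iD (V_rep p)"
proof -
  have reach: "\<exists>x. V.act x (V_elt F G) = V_elt 1 0" if "\<not> p dvd F" for F G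
  proof -
    obtain g where g: "p dvd g * F - 1"
      using inverse_mod_real_min_poly \<open>\<not> p dvd F\<close> unfolding c(2) by blast
    define H where "H = pcompose g s * G"
    have 1: "V.act (at_a g) (V_elt F G) = V_elt 1 H"
      using g by (simp add: act_at_a V_elt_eq_iff H_def)
    obtain q where q: "p dvd q + H" "\<not> p dvd 1 - pcompose q s * H"
      using quaternionic_obstruction[OF c] by blast
    have "V.act (gen Gb + at_a (- q)) (V_elt 1 H) = V_elt (- H - q) (1 - pcompose q s * H)"
      by (simp add: V.act_plus act_b act_at_a V_add pcompose_uminus)
    also have "\<dots> = V_elt 0 (1 - pcompose q s * H)"
      using q(1) by (simp add: V_elt_eq_iff) (metis add.commute dvd_minus_iff minus_add_distrib uminus_add_conv_diff)
    finally have 2: "V.act (gen Gb * (gen Gb + at_a (- q))) (V_elt 1 H) = V_elt (- (1 - pcompose q s * H)) 0"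
      by (simp add: V.act_times act_b)
    have "\<not> p dvd - (1 - pcompose q s * H)" using q(2) by (simp only: dvd_minus_iff not_False_eq_True)
    then obtain k where "p dvd k * - (1 - pcompose q s * H) - 1"
      using inverse_mod_real_min_poly unfolding c(2) by blast
    hence "V.act (at_a k) (V_elt (- (1 - pcompose q s * H)) 0) = V_elt 1 0"
      by (simp add: act_at_a V_elt_eq_iff)
    hence "V.act (at_a k * (gen Gb * (gen Gb + at_a (- q))) * at_a g) (V_elt F G) = V_elt 1 0"
      using 1 2 by (simp only: V.act_times V_elt_closed V.act_closed)
    thus ?thesis ..
  qed
  have reach': "\<exists>x. V.act x v = V_elt 1 0" if v: "v \<in> carrier (V_rep p)" "v \<noteq> \<zero>\<^bsub>V_rep p\<^esub>" for v
  proof -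
    obtain F G where FG: "v = V_elt F G" using v unfolding V_carrier by blast
    show ?thesis
    proof (cases "p dvd F")
      case True
      hence "\<not> p dvd - G" using v(2) by (simp add: FG V_zero V_elt_eq_iff)
      then obtain x where "V.act x (V_elt (- G) F) = V_elt 1 0" using reach by blast
      hence "V.act (x * gen Gb) v = V_elt 1 0" by (simp add: FG V.act_times act_b)
      thus ?thesis ..
    qed (use reach FG in blast)
  qed
  have "\<exists>x. w = V.act x v"
    if v: "v \<in> carrier (V_rep p)" "v \<noteq> \<zero>\<^bsub>V_rep p\<^esub>" and w: "w \<in> carrier (V_rep p)" for v w
  proof -
    obtain x where x: "V.act x v = V_elt 1 0" using reach'[OF v] by blast
    obtain F G where "w = V_elt F G" using w unfolding V_carrier by blast
    hence "w = V.act (normal_form F G * x) v" using v x by (simp add: V.act_times act_normal_form)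
    thus ?thesis ..
  qed
  moreover have "V_elt 1 0 \<noteq> V_elt 0 0"
    using real_min_poly_dvd_iff[of c 1] by (simp add: V_elt_eq_iff c(2)[symmetric])
  hence "carrier (V_rep p) \<noteq> {\<zero>\<^bsub>V_rep p\<^esub>}"
    unfolding V_zero by (metis V_elt_closed singletonD)
  ultimately show ?thesis unfolding V.irreducible_iff_transitive by (intro conjI ballI impI)
qed

lemma (in t_invertible) finite_dimensional_V_rep:
  assumes "p = real_min_poly c"
  shows "finite_dimensional_rep (V_rep p)"
proof -
  let ?t = "[:0, 1:] :: real poly"
  define S where "S = {V_elt 1 0, V_elt ?t 0, V_elt 0 1, V_elt 0 ?t}"
  have S: "finite S" "S \<subseteq> carrier (V_rep p)" by (auto simp: S_def)
  define L where "L = range (V.real_comb S)"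
  have add: "v \<oplus>\<^bsub>V_rep p\<^esub> w \<in> L" if "v \<in> L" "w \<in> L" for v w
    using that S V.real_comb_add[of S] by (auto simp: L_def) (metis rangeI)
  have scale: "V.act (Poly_Mapping.single 0 r) v \<in> L" if "v \<in> S" for r v
    using V.real_comb_in_span[OF S that, of r] by (auto simp: L_def)
  have "v \<in> L" if v: "v \<in> carrier (V_rep p)" for v
  proof -
    obtain F G where FG: "v = V_elt F G" using v unfolding V_carrier by blast
    have p: "p \<noteq> 0" "degree p \<le> 2" by (simp_all add: assms real_min_poly_def)
    have "degree (f mod p) \<le> 1" for f
      using degree_mod_less[of p f] p by fastforce
    then obtain x y z w where xyzw: "F mod p = [:x, y:]" "G mod p = [:z, w:]"
      by (metis degree_le_1E)
    have "v = V_elt (F mod p) (G mod p)"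
      unfolding FG V_elt_eq_iff by (simp add: minus_mod_eq_mult_div)
    also have "\<dots> = V_elt (smult x 1 + (smult y ?t + (smult z 0 + smult w 0)))
        (smult x 0 + (smult y 0 + (smult z 1 + smult w ?t)))"
      by (simp add: xyzw)
    also have "\<dots> \<in> L"
      unfolding V_add[symmetric] act_scalar[symmetric]
      by (intro add scale) (auto simp: S_def)
    finally show ?thesis .
  qed
  thus ?thesis using S unfolding V.finite_dimensional_rep_iff L_def by blast
qed

lemma t_invertible_real_min_poly:
  assumes "c \<noteq> 0"
  obtains s where "t_invertible (real_min_poly c) s"
  using inverse_mod_real_min_poly[of c "[:0, 1:]"] assms
  by (auto simp: real_min_poly_dvd_iff t_invertible_def)

section \<open>The classification\<close>

theorem corollary1p2:
  shows "(\<forall>p. admissible p \<longrightarrow> finite_dimensional_rep (V_rep p) \<and> irreducible_module iD (V_rep p)) \<and>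
    (\<forall>M :: (free_alg set, 'v) module.
      finite_dimensional_rep M \<and> irreducible_module iD M \<longrightarrow>
      (\<exists>p. admissible p \<and> module_isomorphic iD M (V_rep p)))"
proof (intro conjI allI impI)
  fix p assume "admissible p"
  then obtain c where c: "c \<noteq> 0" "p = real_min_poly c" unfolding admissible_iff by blast
  then obtain s where "t_invertible p s" using t_invertible_real_min_poly by metis
  then interpret t_invertible p s .
  show "finite_dimensional_rep (V_rep p)" by (rule finite_dimensional_V_rep[OF c(2)])
  show "irreducible_module iD (V_rep p)" by (rule irreducible_V_rep[OF c])
next
  fix M :: "(free_alg set, 'v) module"
  assume M: "finite_dimensional_rep M \<and> irreducible_module iD M"
  have "left_module iD M" using M unfolding irreducible_module_def by blast
  then interpret M: iD_module M by (rule iD_module.intro)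
  have "carrier M \<noteq> {\<zero>\<^bsub>M\<^esub>}" using M unfolding irreducible_module_def by blast
  then obtain c u where c: "c \<noteq> 0" and u: "u \<in> carrier M" "u \<noteq> \<zero>\<^bsub>M\<^esub>"
    "M.act (at_a (real_min_poly c)) u = \<zero>\<^bsub>M\<^esub>"
    using M.minimal_polynomial_vector M by blast
  obtain s where "t_invertible (real_min_poly c) s" using t_invertible_real_min_poly[OF c] .
  then interpret t_invertible "real_min_poly c" s .
  have "module_isomorphic iD M (V_rep (real_min_poly c))"
  proof (rule isomorphic_if_annihilator_subset)
    show "irreducible_module iD M" using M by blast
    show "irreducible_module iD (V_rep (real_min_poly c))" by (rule irreducible_V_rep[OF c refl])
    show "u \<in> carrier M" "u \<noteq> \<zero>\<^bsub>M\<^esub>" by (rule u)+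
    show "V_elt 1 0 \<in> carrier (V_rep (real_min_poly c))" by (rule V_elt_closed)
    show "M.act x u = \<zero>\<^bsub>M\<^esub>" if "V.act x (V_elt 1 0) = \<zero>\<^bsub>V_rep (real_min_poly c)\<^esub>" for x
      by (rule M.act_left_multiples[OF u(1,3) annihilator_of_generator[OF that]])
  qed
  moreover have "admissible (real_min_poly c)" using c unfolding admissible_iff by blast
  ultimately show "\<exists>p. admissible p \<and> module_isomorphic iD M (V_rep p)" by blast
qed

end
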